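(* There exist finitely generated residually finite groups $G$ and $H$, with $G$ amenable and $H$ non-amenable, and free exact odometers $X$ and $Y$ of $G$ and $H$, respectively, such that $[[L_X]]\cong[[L_Y]]$ as abstract groups.
   Context: Let $G$ be a countable group. A scale of $G$ is a decreasing sequence $(\Gamma_n)_{n\in\mathbb{N}}$ of normal finite-index subgroups of $G$ with $\bigcap_n\Gamma_n=\{1_G\}$. The free exact odometer associated with the scale is $X=G_{(\Gamma_n)}=\{(x_n)_n\in\prod_n G/\Gamma_n : x_{n+1}\mapsto x_n \text{ under } G/\Gamma_{n+1}\to G/\Gamma_n \text{ for all } n\}$, a subgroup of the product group with the topology induced by the product of the discrete topologies. A free exact odometer of $G$ is one associated with some scale of $G$. $L_X$ is the action of the group $X$ on the space $X$ given by $L_X^{\xi}(x)=\xi x$. For an action $\alpha$ of a (not necessarily countable) group $K$ by homeomorphisms on a compact totally disconnected metrizable space $Z$, the topological full group $[[\alpha]]$ is the group of all homeomorphisms $f$ of $Z$ for which there exist a finite clopen partition $\{A_1,\dots,A_k\}$ of $Z$ and $g_1,\dots,g_k\in K$ with $f(y)=\alpha^{g_i}(y)$ for all $y\in A_i$, $1\le i\le k$. *)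

theory Defs
  imports "HOL-Analysis.Analysis" "HOL-Algebra.Bij" "HOL-Algebra.Product_Groups"
begin

section \<open>Finitely generated, residually finite and amenable groups\<close>

definition finitely_generated :: "('a, 'b) monoid_scheme \<Rightarrow> bool" where
  "finitely_generated G \<longleftrightarrow>
     (\<exists>S. finite S \<and> S \<subseteq> carrier G \<and> generate G S = carrier G)"

definition finite_index_normal :: "'a set \<Rightarrow> ('a, 'b) monoid_scheme \<Rightarrow> bool" where
  "finite_index_normal N G \<longleftrightarrow> N \<lhd> G \<and> finite (carrier (G Mod N))"

definition residually_finite :: "('a, 'b) monoid_scheme \<Rightarrow> bool" where
  "residually_finite G \<longleftrightarrow>
     (\<forall>g \<in> carrier G - {\<one>\<^bsub>G\<^esub>}. \<exists>N. finite_index_normal N G \<and> g \<notin> N)"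

text \<open>
  Amenability of a discrete group, in von Neumann's sense: there is a left-invariant finitely
  additive probability measure defined on all subsets of the group. The values of \<open>\<mu>\<close> outside
  the power set of the carrier are irrelevant.
\<close>
definition amenable :: "('a, 'b) monoid_scheme \<Rightarrow> bool" where
  "amenable G \<longleftrightarrow>
     (\<exists>\<mu> :: 'a set \<Rightarrow> real.
        \<mu> (carrier G) = 1 \<and>
        (\<forall>A. A \<subseteq> carrier G \<longrightarrow> 0 \<le> \<mu> A) \<and>
        (\<forall>A B. A \<subseteq> carrier G \<longrightarrow> B \<subseteq> carrier G \<longrightarrow> A \<inter> B = {} \<longrightarrow> \<mu> (A \<union> B) = \<mu> A + \<mu> B) \<and>
        (\<forall>g \<in> carrier G. \<forall>A. A \<subseteq> carrier G \<longrightarrow> \<mu> (g <#\<^bsub>G\<^esub> A) = \<mu> A))"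

section \<open>Scales and free exact odometers\<close>

text \<open>Decreasing is meant in the weak sense: repetitions are allowed.\<close>
definition subgroup_scale :: "('a, 'b) monoid_scheme \<Rightarrow> (nat \<Rightarrow> 'a set) \<Rightarrow> bool" where
  "subgroup_scale G \<Gamma> \<longleftrightarrow>
     (\<forall>n. finite_index_normal (\<Gamma> n) G) \<and> (\<forall>n. \<Gamma> (Suc n) \<subseteq> \<Gamma> n) \<and> (\<Inter>n. \<Gamma> n) = {\<one>\<^bsub>G\<^esub>}"

text \<open>
  The second condition says that the natural map from \<open>G / \<Gamma>\<^sub>n\<^sub>+\<^sub>1\<close> to \<open>G / \<Gamma>\<^sub>n\<close>, which takes the
  coset of \<open>g\<close> to the coset of \<open>g\<close>, sends \<open>x\<^sub>n\<^sub>+\<^sub>1\<close> to \<open>x\<^sub>n\<close>.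
\<close>
definition odometer_set :: "('a, 'b) monoid_scheme \<Rightarrow> (nat \<Rightarrow> 'a set) \<Rightarrow> (nat \<Rightarrow> 'a set) set" where
  "odometer_set G \<Gamma> =
     {x \<in> carrier (product_group UNIV (\<lambda>n. G Mod \<Gamma> n)).
        \<forall>n. \<forall>g \<in> carrier G. x (Suc n) = \<Gamma> (Suc n) #>\<^bsub>G\<^esub> g \<longrightarrow> x n = \<Gamma> n #>\<^bsub>G\<^esub> g}"

definition odometer :: "('a, 'b) monoid_scheme \<Rightarrow> (nat \<Rightarrow> 'a set) \<Rightarrow> (nat \<Rightarrow> 'a set) monoid" where
  "odometer G \<Gamma> = (product_group UNIV (\<lambda>n. G Mod \<Gamma> n)) \<lparr>carrier := odometer_set G \<Gamma>\<rparr>"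

definition odometer_topology ::
  "('a, 'b) monoid_scheme \<Rightarrow> (nat \<Rightarrow> 'a set) \<Rightarrow> (nat \<Rightarrow> 'a set) topology" where
  "odometer_topology G \<Gamma> =
     subtopology (product_topology (\<lambda>n. discrete_topology (carrier (G Mod \<Gamma> n))) UNIV)
       (odometer_set G \<Gamma>)"

section \<open>Topological full groups\<close>

text \<open>
  The argument \<open>\<alpha>\<close> is an action of the group \<open>K\<close> on the space \<open>Z\<close>. Homeomorphisms are represented
  by functions that are \<open>undefined\<close> off the space, as in \<^const>\<open>BijGroup\<close>, so that two of them are
  equal iff they agree on the space.
\<close>
definition topological_full_group ::
  "('k, 'b) monoid_scheme \<Rightarrow> 'z topology \<Rightarrow> ('k \<Rightarrow> 'z \<Rightarrow> 'z) \<Rightarrow> ('z \<Rightarrow> 'z) monoid" where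
  "topological_full_group K Z \<alpha> = (BijGroup (topspace Z))
     \<lparr>carrier := {f \<in> extensional (topspace Z). homeomorphic_map Z Z f \<and>
        (\<exists>P. finite P \<and> partition_on (topspace Z) P \<and>
           (\<forall>A \<in> P. openin Z A \<and> closedin Z A \<and>
              (\<exists>g \<in> carrier K. \<forall>y \<in> A. f y = \<alpha> g y)))}\<rparr>"

definition left_translation :: "('a, 'b) monoid_scheme \<Rightarrow> 'a \<Rightarrow> 'a \<Rightarrow> 'a" where
  "left_translation K \<xi> = (\<lambda>x \<in> carrier K. \<xi> \<otimes>\<^bsub>K\<^esub> x)"

definition odometer_full_group ::
  "('a, 'b) monoid_scheme \<Rightarrow> (nat \<Rightarrow> 'a set) \<Rightarrow> ((nat \<Rightarrow> 'a set) \<Rightarrow> (nat \<Rightarrow> 'a set)) monoid" where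
  "odometer_full_group G \<Gamma> =
     topological_full_group (odometer G \<Gamma>) (odometer_topology G \<Gamma>)
       (left_translation (odometer G \<Gamma>))"

end

theory Submission
  imports Defs
begin

text \<open>
  A countable dense subgroup of a profinite group \<open>X\<close>, with the traces of a neighbourhood basis
  of open normal subgroups as its scale, has odometer \<open>X\<close>, whatever the subgroup is. So it
  suffices to find a finitely generated amenable \<open>G\<close> whose profinite completion \<open>X\<close> along some scale
  contains three involutions that freely generate \<open>C\<^sub>2 * C\<^sub>2 * C\<^sub>2\<close>, and to let \<open>H\<close> be generated
  by \<open>G\<close> and these involutions.

  \<open>G\<close> is a lamplighter-like group of permutations: on level \<open>m\<close> a cyclic street of length
  \<open>4\<^bsup>m+1\<^esup>\<close> has a finite set attached to each house. The generators are the rotation of all streets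
  and, for \<open>i \<le> 3\<close>, an involution acting on the single house \<open>i * 4\<^bsup>m\<^esup>\<close> of every level \<open>m\<close>.
  Since these houses move apart as \<open>m\<close> grows, finitely many conjugates of the involutions by
  rotations commute on all but finitely many levels; hence they generate a finite group, and \<open>G\<close> is
  locally-finite-by-\<open>\<int>\<close>. On the other hand the divisibility of the positions makes a suitable
  commutator of such conjugates act on one level only, so that the closure of \<open>G\<close> contains arbitrary
  products of these commutators over the levels. On level \<open>m\<close> they are chosen to witness that
  the \<open>m\<close>-th reduced word in the three involutions is nontrivial.
\<close>

section \<open>Odometers of dense subgroups\<close>

text \<open>A full group sees the acting group only through the set of its homeomorphisms. Hence the
  intertwining is asked for each \<open>g\<close> separately, with a \<open>g'\<close> that depends
  on \<open>g\<close>, and on each piece of the image partition \<open>g'\<close> takes over from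
  \<open>g\<close>.\<close>

lemma conj_in_topological_full_group:
  assumes h: "homeomorphic_maps Z Z' \<phi> \<psi>"
    and eq: "\<And>g. g \<in> carrier K \<Longrightarrow> \<exists>g'\<in>carrier K'. \<forall>z\<in>topspace Z. \<phi> (\<alpha> g z) = \<alpha>' g' (\<phi> z)"
    and f: "f \<in> carrier (topological_full_group K Z \<alpha>)"
  shows "restrict (\<phi> \<circ> f \<circ> \<psi>) (topspace Z') \<in> carrier (topological_full_group K' Z' \<alpha>')"
proof -
  have fh: "homeomorphic_map Z Z f"
    using f by (simp add: topological_full_group_def)
  obtain P where P: "finite P" "partition_on (topspace Z) P"
    "\<And>A. A \<in> P \<Longrightarrow> openin Z A \<and> closedin Z A \<and> (\<exists>g \<in> carrier K. \<forall>y \<in> A. f y = \<alpha> g y)"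
    using f by (auto simp: topological_full_group_def)
  have h': "homeomorphic_map Z Z' \<phi>" "homeomorphic_map Z' Z \<psi>"
    using h homeomorphic_maps_map by blast+
  have inv: "\<And>z. z \<in> topspace Z \<Longrightarrow> \<psi> (\<phi> z) = z" "\<And>z. z \<in> topspace Z' \<Longrightarrow> \<phi> (\<psi> z) = z"
    using h by (auto simp: homeomorphic_maps_def)
  have cl: "\<And>z. z \<in> topspace Z \<Longrightarrow> \<phi> z \<in> topspace Z'" "\<And>z. z \<in> topspace Z' \<Longrightarrow> \<psi> z \<in> topspace Z"
    using h' homeomorphic_imp_surjective_map by blast+
  have "homeomorphic_map Z' Z' (\<phi> \<circ> f \<circ> \<psi>)"
    using h' fh by (metis homeomorphic_map_compose)
  then have 1: "homeomorphic_map Z' Z' (restrict (\<phi> \<circ> f \<circ> \<psi>) (topspace Z'))"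
    by (rule homeomorphic_map_eq) auto
  have im: "\<phi> ` topspace Z = topspace Z'"
    using h'(1) homeomorphic_imp_surjective_map by blast
  have inj: "inj_on \<phi> (topspace Z)"
    by (metis inj_onI inv(1))
  have part: "partition_on (topspace Z') ((`) \<phi> ` P - {{}})"
    using partition_on_inj_image[OF P(2) inj] im by simp
  have "openin Z' B \<and> closedin Z' B \<and> (\<exists>g \<in> carrier K'. \<forall>y \<in> B. restrict (\<phi> \<circ> f \<circ> \<psi>) (topspace Z') y = \<alpha>' g y)"
    if "B \<in> (`) \<phi> ` P - {{}}" for B
  proof -
    obtain A where A: "A \<in> P" "B = \<phi> ` A" using \<open>B \<in> _\<close> by auto
    obtain g where g: "g \<in> carrier K" "\<forall>y \<in> A. f y = \<alpha> g y" using P(3)[OF A(1)] by auto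
    obtain g' where g': "g' \<in> carrier K'" "\<forall>z\<in>topspace Z. \<phi> (\<alpha> g z) = \<alpha>' g' (\<phi> z)"
      using eq[OF g(1)] by auto
    have AZ: "A \<subseteq> topspace Z" using P(3)[OF A(1)] openin_subset by blast
    have "openin Z' B" "closedin Z' B"
      using P(3)[OF A(1)] h'(1) A(2) AZ homeomorphic_map_openness homeomorphic_map_closedness by blast+
    moreover have "\<forall>y\<in>B. restrict (\<phi> \<circ> f \<circ> \<psi>) (topspace Z') y = \<alpha>' g' y"
    proof
      fix y assume "y \<in> B"
      then obtain x where x: "x \<in> A" "y = \<phi> x" using A(2) by blast
      then have "x \<in> topspace Z" using AZ by blast
      then show "restrict (\<phi> \<circ> f \<circ> \<psi>) (topspace Z') y = \<alpha>' g' y"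
        using x g(2) g'(2) cl(1) inv(1) by simp
    qed
    ultimately show ?thesis using g'(1) by blast
  qed
  moreover have "finite ((`) \<phi> ` P - {{}})" using P(1) by simp
  ultimately have "\<exists>P. finite P \<and> partition_on (topspace Z') P \<and>
      (\<forall>A\<in>P. openin Z' A \<and> closedin Z' A \<and>
        (\<exists>g\<in>carrier K'. \<forall>y\<in>A. restrict (\<phi> \<circ> f \<circ> \<psi>) (topspace Z') y = \<alpha>' g y))"
    using part by meson
  with 1 show ?thesis
    unfolding topological_full_group_def by (simp del: restrict_apply)
qed

lemma topological_full_groupD:
  assumes "f \<in> carrier (topological_full_group K Z \<alpha>)"
  shows "f \<in> extensional (topspace Z)" "z \<in> topspace Z \<Longrightarrow> f z \<in> topspace Z"
    "f \<in> Bij (topspace Z)"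
proof -
  show e: "f \<in> extensional (topspace Z)"
    using assms by (simp add: topological_full_group_def)
  have h: "homeomorphic_map Z Z f"
    using assms by (simp add: topological_full_group_def)
  then have "bij_betw f (topspace Z) (topspace Z)"
    by (simp add: bij_betw_def homeomorphic_imp_surjective_map homeomorphic_imp_injective_map)
  with e show "f \<in> Bij (topspace Z)" by (simp add: Bij_def)
  show "f z \<in> topspace Z" if "z \<in> topspace Z"
    using homeomorphic_imp_surjective_map[OF h] that by blast
qed

lemma topological_full_group_iso:
  assumes h: "homeomorphic_maps Z Z' \<phi> \<psi>"
    and eq: "\<And>g. g \<in> carrier K \<Longrightarrow> \<exists>g'\<in>carrier K'. \<forall>z\<in>topspace Z. \<phi> (\<alpha> g z) = \<alpha>' g' (\<phi> z)"
    and eq': "\<And>g. g \<in> carrier K' \<Longrightarrow> \<exists>g'\<in>carrier K. \<forall>z\<in>topspace Z'. \<psi> (\<alpha>' g z) = \<alpha> g' (\<psi> z)"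
  shows "topological_full_group K Z \<alpha> \<cong> topological_full_group K' Z' \<alpha>'" (is "?F \<cong> ?F'")
proof -
  let ?c = "\<lambda>f. restrict (\<phi> \<circ> f \<circ> \<psi>) (topspace Z')"
  let ?d = "\<lambda>f. restrict (\<psi> \<circ> f \<circ> \<phi>) (topspace Z)"
  have h': "homeomorphic_map Z Z' \<phi>" "homeomorphic_map Z' Z \<psi>"
    using h homeomorphic_maps_map by blast+
  have inv: "\<And>z. z \<in> topspace Z \<Longrightarrow> \<psi> (\<phi> z) = z" "\<And>z. z \<in> topspace Z' \<Longrightarrow> \<phi> (\<psi> z) = z"
    using h by (auto simp: homeomorphic_maps_def)
  have cl: "\<And>z. z \<in> topspace Z \<Longrightarrow> \<phi> z \<in> topspace Z'" "\<And>z. z \<in> topspace Z' \<Longrightarrow> \<psi> z \<in> topspace Z"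
    using h' homeomorphic_imp_surjective_map by blast+
  note ext = topological_full_groupD[of _ K Z \<alpha>]
  note ext' = topological_full_groupD[of _ K' Z' \<alpha>']
  have c: "?c f \<in> carrier ?F'" if "f \<in> carrier ?F" for f
    by (rule conj_in_topological_full_group[OF h eq that])
  have d: "?d f \<in> carrier ?F" if "f \<in> carrier ?F'" for f
    by (rule conj_in_topological_full_group[OF _ eq' that])
      (use h homeomorphic_maps_sym in blast)
  have "bij_betw ?c (carrier ?F) (carrier ?F')"
  proof (rule bij_betw_byWitness[where f' = ?d])
    show "\<forall>f\<in>carrier ?F. ?d (?c f) = f"
      using ext(1,2) inv cl by (auto intro!: extensionalityI[where A="topspace Z"])
    show "\<forall>f\<in>carrier ?F'. ?c (?d f) = f"
      using ext'(1,2) inv cl by (auto intro!: extensionalityI[where A="topspace Z'"])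
  qed (use c d in auto)
  moreover have "?c \<in> hom ?F ?F'"
  proof (rule homI)
    fix f g assume fg: "f \<in> carrier ?F" "g \<in> carrier ?F"
    have "f \<otimes>\<^bsub>?F\<^esub> g = compose (topspace Z) f g"
      using ext(3) fg by (simp add: topological_full_group_def BijGroup_def)
    moreover have "?c f \<otimes>\<^bsub>?F'\<^esub> ?c g = compose (topspace Z') (?c f) (?c g)"
      using ext'(3)[OF c[OF fg(1)]] ext'(3)[OF c[OF fg(2)]]
      by (simp add: topological_full_group_def BijGroup_def)
    ultimately show "?c (f \<otimes>\<^bsub>?F\<^esub> g) = ?c f \<otimes>\<^bsub>?F'\<^esub> ?c g"
      using inv cl ext(2) fg by (auto simp: fun_eq_iff compose_def)
  qed (use c in auto)
  ultimately show ?thesis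
    unfolding is_iso_def iso_def by blast
qed


section \<open>Odometers and coordinatewise maps between them\<close>

lemma odometer_setI:
  assumes "\<And>n. x n \<in> carrier (K Mod \<Theta> n)"
    and "\<And>n g. g \<in> carrier K \<Longrightarrow> x (Suc n) = \<Theta> (Suc n) #>\<^bsub>K\<^esub> g \<Longrightarrow> x n = \<Theta> n #>\<^bsub>K\<^esub> g"
  shows "x \<in> odometer_set K \<Theta>"
  unfolding odometer_set_def
proof (intro CollectI conjI allI ballI impI)
  show "x \<in> carrier (product_group UNIV (\<lambda>n. K Mod \<Theta> n))"
    using assms(1) by (auto simp only: carrier_product_group PiE_iff extensional_UNIV UNIV_I)
qed (rule assms(2))

lemma odometer_setD:
  assumes "x \<in> odometer_set K \<Theta>"
  shows "x n \<in> carrier (K Mod \<Theta> n)"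
    and "g \<in> carrier K \<Longrightarrow> x (Suc n) = \<Theta> (Suc n) #>\<^bsub>K\<^esub> g \<Longrightarrow> x n = \<Theta> n #>\<^bsub>K\<^esub> g"
proof -
  have "x \<in> carrier (product_group UNIV (\<lambda>n. K Mod \<Theta> n))"
    using assms unfolding odometer_set_def by (elim CollectE conjE)
  then show "x n \<in> carrier (K Mod \<Theta> n)" by auto
  show "g \<in> carrier K \<Longrightarrow> x (Suc n) = \<Theta> (Suc n) #>\<^bsub>K\<^esub> g \<Longrightarrow> x n = \<Theta> n #>\<^bsub>K\<^esub> g"
    using assms unfolding odometer_set_def by blast
qed

lemma topspace_odometer: "topspace (odometer_topology K \<Theta>) = odometer_set K \<Theta>"
proof -
  have "odometer_set K \<Theta> \<subseteq> topspace (product_topology (\<lambda>n. discrete_topology (carrier (K Mod \<Theta> n))) UNIV)"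
    using odometer_setD(1) by (auto simp only: topspace_product_topology topspace_discrete_topology PiE_iff extensional_UNIV UNIV_I)
  then show ?thesis unfolding odometer_topology_def topspace_subtopology by (rule Int_absorb1)
qed

lemma left_translation_odometer:
  "z \<in> odometer_set K \<Theta> \<Longrightarrow> left_translation (odometer K \<Theta>) \<xi> z = (\<lambda>n. \<xi> n <#>\<^bsub>K\<^esub> z n)"
  unfolding left_translation_def odometer_def by (simp add: restrict_def)

lemma continuous_map_odometer:
  assumes "\<And>x. x \<in> odometer_set K \<Theta> \<Longrightarrow> (\<lambda>n. a n (x n)) \<in> odometer_set K' \<Theta>'"
    and "\<And>n C. C \<in> carrier (K Mod \<Theta> n) \<Longrightarrow> a n C \<in> carrier (K' Mod \<Theta>' n)"
  shows "continuous_map (odometer_topology K \<Theta>) (odometer_topology K' \<Theta>') (\<lambda>x n. a n (x n))"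
proof -
  let ?d = "\<lambda>n. discrete_topology (carrier (K Mod \<Theta> n))"
  have "continuous_map (subtopology (product_topology ?d UNIV) (odometer_set K \<Theta>))
          (discrete_topology (carrier (K' Mod \<Theta>' n))) (\<lambda>x. a n (x n))" for n
  proof -
    have "continuous_map (?d n) (discrete_topology (carrier (K' Mod \<Theta>' n))) (a n)"
      using assms(2) by auto
    moreover have "continuous_map (product_topology ?d UNIV) (?d n) (\<lambda>x. x n)"
      by (rule continuous_map_product_projection) simp
    ultimately have "continuous_map (product_topology ?d UNIV) (discrete_topology (carrier (K' Mod \<Theta>' n)))
        (a n \<circ> (\<lambda>x. x n))"
      by (rule continuous_map_compose[rotated])
    then
    show ?thesis
      unfolding comp_def by (rule continuous_map_from_subtopology)
  qed
  moreover have "(\<lambda>x n. a n (x n)) \<in> topspace (subtopology (product_topology ?d UNIV) (odometer_set K \<Theta>))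
      \<rightarrow> odometer_set K' \<Theta>'"
    using assms(1) by simp
  ultimately show ?thesis
    unfolding odometer_topology_def continuous_map_in_subtopology continuous_map_componentwise_UNIV
    by blast
qed

section \<open>Coset spaces of a dense subgroup\<close>

text \<open>The condition \<open>dense\<close> says that \<open>G\<close> meets every coset of every
  \<open>\<Delta> n\<close>. So the inclusion of \<open>G\<close> induces isomorphisms of
  \<open>G / (G \<inter> \<Delta> n)\<close> with \<open>H / \<Delta> n\<close>, given on cosets by
  \<open>C \<mapsto> \<Delta> n <#> C\<close> with inverse \<open>D \<mapsto> D \<inter> G\<close>;
  taken coordinatewise they identify the two odometers.\<close>

locale dense_subgroup = group H for H (structure) +
  fixes G :: "'a set" and \<Delta> :: "nat \<Rightarrow> 'a set"
  assumes G: "subgroup G H"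
    and normal: "\<And>n. \<Delta> n \<lhd> H"
    and decr: "\<And>n. \<Delta> (Suc n) \<subseteq> \<Delta> n"
    and dense: "\<And>n h. h \<in> carrier H \<Longrightarrow> \<exists>g\<in>G. h \<in> \<Delta> n #> g"
begin

abbreviation G' where "G' \<equiv> H\<lparr>carrier := G\<rparr>"

definition \<Gamma> where "\<Gamma> n = G \<inter> \<Delta> n"

lemma G_sub: "g \<in> G \<Longrightarrow> g \<in> carrier H"
  using G subgroup.mem_carrier by metis

lemma \<Delta>_subgroup: "subgroup (\<Delta> n) H"
  using normal normal_imp_subgroup by blast

lemma normal_\<Gamma>: "\<Gamma> n \<lhd> G'"
  using normal_Int_subgroup[OF G normal[of n]] by (simp add: \<Gamma>_def Int_commute)

lemma r_coset_G': "A #>\<^bsub>G'\<^esub> g = A #> g"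
  by (simp add: r_coset_def)

lemma set_mult_G': "A <#>\<^bsub>G'\<^esub> B = A <#> B"
  by (simp add: set_mult_def)

lemma extend_coset:
  assumes "g \<in> G" shows "\<Delta> n <#> (\<Gamma> n #> g) = \<Delta> n #> g"
proof -
  have s: "\<Gamma> n \<subseteq> carrier H" "\<Delta> n \<subseteq> carrier H"
    using \<Delta>_subgroup subgroup.subset by (auto simp: \<Gamma>_def)
  have "\<Delta> n <#> \<Gamma> n = \<Delta> n"
  proof
    show "\<Delta> n <#> \<Gamma> n \<subseteq> \<Delta> n"
      using \<Delta>_subgroup[of n] by (auto simp: set_mult_def \<Gamma>_def subgroup.m_closed)
    show "\<Delta> n \<subseteq> \<Delta> n <#> \<Gamma> n"
    proof
      fix d assume d: "d \<in> \<Delta> n"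
      have "\<one> \<in> \<Gamma> n"
        using \<Delta>_subgroup G by (simp add: \<Gamma>_def subgroup.one_closed)
      moreover have "d = d \<otimes> \<one>" using d s by auto
      ultimately show "d \<in> \<Delta> n <#> \<Gamma> n"
        using d unfolding set_mult_def by blast
    qed
  qed
  then show ?thesis
    using setmult_rcos_assoc[of "\<Delta> n" "\<Gamma> n" g] s assms G_sub by simp
qed

lemma restrict_coset:
  assumes "g \<in> G" shows "(\<Delta> n #> g) \<inter> G = \<Gamma> n #> g"
proof
  show "(\<Delta> n #> g) \<inter> G \<subseteq> \<Gamma> n #> g"
  proof
    fix x assume "x \<in> (\<Delta> n #> g) \<inter> G"
    then obtain d where d: "d \<in> \<Delta> n" "x = d \<otimes> g" "x \<in> G" by (auto simp: r_coset_def)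
    have dc: "d \<in> carrier H" using d \<Delta>_subgroup subgroup.mem_carrier by metis
    have "d = x \<otimes> inv g" using d dc assms G_sub by (simp add: m_assoc)
    then have "d \<in> G" using d assms G by (metis subgroup.m_closed subgroup.m_inv_closed)
    then show "x \<in> \<Gamma> n #> g" using d by (auto simp: r_coset_def \<Gamma>_def)
  qed
  show "\<Gamma> n #> g \<subseteq> (\<Delta> n #> g) \<inter> G"
    using assms G by (auto simp: r_coset_def \<Gamma>_def subgroup.m_closed)
qed

lemma carrier_Mod_\<Gamma>: "carrier (G' Mod \<Gamma> n) = (\<lambda>g. \<Gamma> n #> g) ` G"
  by (simp add: carrier_FactGroup r_coset_G')

text \<open>A representative found at level \<open>n\<close> serves all lower levels since the
  \<open>\<Delta> k\<close> decrease. The compatibility condition of an odometer needs one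
  \<open>g\<close> for two consecutive levels.\<close>

lemma dense_coset:
  assumes "h \<in> carrier H" obtains g where "g \<in> G" "\<And>k. k \<le> n \<Longrightarrow> \<Delta> k #> h = \<Delta> k #> g"
proof -
  obtain g where g: "g \<in> G" "h \<in> \<Delta> n #> g" using dense[OF assms] by blast
  have "\<Delta> k #> h = \<Delta> k #> g" if "k \<le> n" for k
  proof -
    have "\<Delta> n \<subseteq> \<Delta> k" using that decr lift_Suc_antimono_le by metis
    then have "h \<in> \<Delta> k #> g" using g(2) by (auto simp: r_coset_def)
    then show ?thesis using repr_independence[OF _ G_sub[OF g(1)] \<Delta>_subgroup] by metis
  qed
  with g that show ?thesis by blast
qed

lemma carrier_Mod_\<Delta>: "carrier (H Mod \<Delta> n) = (\<lambda>g. \<Delta> n #> g) ` G"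
proof -
  have "\<Delta> n #> h \<in> (\<lambda>g. \<Delta> n #> g) ` G" if "h \<in> carrier H" for h
    using dense_coset[OF that, of n] by (metis image_eqI order_refl)
  then show ?thesis
    unfolding carrier_FactGroup using G_sub by blast
qed

lemma Mod_inverse:
  "C \<in> carrier (G' Mod \<Gamma> n) \<Longrightarrow> \<Delta> n <#> C \<in> carrier (H Mod \<Delta> n)"
  "D \<in> carrier (H Mod \<Delta> n) \<Longrightarrow> D \<inter> G \<in> carrier (G' Mod \<Gamma> n)"
  "C \<in> carrier (G' Mod \<Gamma> n) \<Longrightarrow> (\<Delta> n <#> C) \<inter> G = C"
  "D \<in> carrier (H Mod \<Delta> n) \<Longrightarrow> \<Delta> n <#> (D \<inter> G) = D"
  unfolding carrier_Mod_\<Gamma> carrier_Mod_\<Delta>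
  by (elim imageE; simp add: extend_coset restrict_coset)+

lemma Mod_mult:
  assumes "C \<in> carrier (G' Mod \<Gamma> n)" "D \<in> carrier (G' Mod \<Gamma> n)"
  shows "\<Delta> n <#> (C <#> D) = (\<Delta> n <#> C) <#> (\<Delta> n <#> D)"
proof -
  obtain c d where cd: "c \<in> G" "C = \<Gamma> n #> c" "d \<in> G" "D = \<Gamma> n #> d"
    using assms by (auto simp: carrier_Mod_\<Gamma>)
  have "C <#> D = \<Gamma> n #> (c \<otimes> d)"
    using normal.rcos_sum[OF normal_\<Gamma>[of n], of c d] cd by (simp add: r_coset_G' set_mult_G')
  moreover have "(\<Delta> n #> c) <#> (\<Delta> n #> d) = \<Delta> n #> (c \<otimes> d)"
    using normal.rcos_sum[OF normal[of n], of c d] cd G_sub by simp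
  moreover have "c \<otimes> d \<in> G" using cd G by (simp add: subgroup.m_closed)
  ultimately show ?thesis using cd by (simp add: extend_coset)
qed

text \<open>Obtained from \<open>Mod_mult\<close> through the inverse bijection, with
  \<open>C\<close> and \<open>D\<close> written as the extensions of their traces on
  \<open>G\<close>.\<close>

lemma Mod_mult':
  assumes "C \<in> carrier (H Mod \<Delta> n)" "D \<in> carrier (H Mod \<Delta> n)"
  shows "(C <#> D) \<inter> G = (C \<inter> G) <#> (D \<inter> G)"
proof -
  note m = Mod_inverse(2)[OF assms(1)] Mod_inverse(2)[OF assms(2)]
  have "(C \<inter> G) <#> (D \<inter> G) \<in> carrier (G' Mod \<Gamma> n)"
    using monoid.m_closed[OF group.is_monoid[OF normal.factorgroup_is_group[OF normal_\<Gamma>]] m]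
    by (simp add: set_mult_G')
  from Mod_inverse(3)[OF this] show ?thesis
    unfolding Mod_mult[OF m] Mod_inverse(4)[OF assms(1)] Mod_inverse(4)[OF assms(2)] .
qed

lemma finite_index_\<Gamma>:
  assumes "finite_index_normal (\<Delta> n) H"
  shows "finite_index_normal (\<Gamma> n) G'"
proof -
  have "carrier (G' Mod \<Gamma> n) \<subseteq> (\<lambda>D. D \<inter> G) ` carrier (H Mod \<Delta> n)"
  proof
    fix C assume C: "C \<in> carrier (G' Mod \<Gamma> n)"
    show "C \<in> (\<lambda>D. D \<inter> G) ` carrier (H Mod \<Delta> n)"
    proof (rule image_eqI)
      show "C = (\<Delta> n <#> C) \<inter> G" using Mod_inverse(3)[OF C] by (rule sym)
      show "\<Delta> n <#> C \<in> carrier (H Mod \<Delta> n)" by (rule Mod_inverse(1)[OF C])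
    qed
  qed
  moreover have "finite (carrier (H Mod \<Delta> n))"
    using assms by (simp add: finite_index_normal_def)
  ultimately show ?thesis
    using normal_\<Gamma> by (auto simp: finite_index_normal_def intro: finite_surj)
qed

lemma odometer_maps:
  "x \<in> odometer_set G' \<Gamma> \<Longrightarrow> (\<lambda>n. \<Delta> n <#> x n) \<in> odometer_set H \<Delta>"
  "y \<in> odometer_set H \<Delta> \<Longrightarrow> (\<lambda>n. y n \<inter> G) \<in> odometer_set G' \<Gamma>"
proof -
  assume x: "x \<in> odometer_set G' \<Gamma>"
  note c = odometer_setD(1)[OF x]
  have "\<Delta> n <#> x n = \<Delta> n #> h"
    if h: "h \<in> carrier H" and e: "\<Delta> (Suc n) <#> x (Suc n) = \<Delta> (Suc n) #> h" for n h
  proof -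
    \<comment> \<open>Compatibility in the target quantifies over all \<open>h\<close> in
      \<open>H\<close>; \<open>h\<close> is replaced by an element of \<open>G\<close> with the same
      cosets on both levels, to which the compatibility of \<open>x\<close> applies.\<close>
    obtain g where g: "g \<in> G" "\<And>k. k \<le> Suc n \<Longrightarrow> \<Delta> k #> h = \<Delta> k #> g"
      using dense_coset[OF h] by metis
    have "x (Suc n) = \<Gamma> (Suc n) #> g"
      using Mod_inverse(3)[OF c[of "Suc n"]] restrict_coset[OF g(1), of "Suc n"] g(2)[of "Suc n"]
      unfolding e by simp
    then have "x n = \<Gamma> n #> g"
      using odometer_setD(2)[OF x, of g n] g(1) by (simp add: r_coset_G')
    then show ?thesis using extend_coset[OF g(1), of n] g(2)[of n] by simp
  qed
  then show "(\<lambda>n. \<Delta> n <#> x n) \<in> odometer_set H \<Delta>"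
    by (intro odometer_setI Mod_inverse(1)[OF c])
next
  assume y: "y \<in> odometer_set H \<Delta>"
  note c = odometer_setD(1)[OF y]
  have *: "y n \<inter> G = \<Gamma> n #> g" if g: "g \<in> G" and e: "y (Suc n) \<inter> G = \<Gamma> (Suc n) #> g" for n g
  proof -
    have "y (Suc n) = \<Delta> (Suc n) #> g"
      using Mod_inverse(4)[OF c[of "Suc n"]] extend_coset[OF g, of "Suc n"] unfolding e by simp
    then have "y n = \<Delta> n #> g" by (rule odometer_setD(2)[OF y G_sub[OF g]])
    then show ?thesis using restrict_coset[OF g, of n] by simp
  qed
  show "(\<lambda>n. y n \<inter> G) \<in> odometer_set G' \<Gamma>"
  proof (rule odometer_setI, rule Mod_inverse(2)[OF c])
    fix n g assume "g \<in> carrier G'" and e: "y (Suc n) \<inter> G = \<Gamma> (Suc n) #>\<^bsub>G'\<^esub> g"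
    then have "g \<in> G" by simp
    then show "y n \<inter> G = \<Gamma> n #>\<^bsub>G'\<^esub> g"
      using e unfolding r_coset_G' by (rule *)
  qed
qed

text \<open>The coordinatewise maps are mutually inverse homeomorphisms and multiplicative, so they
  carry the translation by \<open>g\<close> to the translation by the image of
  \<open>g\<close>.\<close>

lemma odometer_full_group_iso: "odometer_full_group G' \<Gamma> \<cong> odometer_full_group H \<Delta>"
  unfolding odometer_full_group_def
proof (rule topological_full_group_iso[where \<phi> = "\<lambda>x n. \<Delta> n <#> x n" and \<psi> = "\<lambda>y n. y n \<inter> G"],
    unfold topspace_odometer)
  have "\<And>x. x \<in> odometer_set G' \<Gamma> \<Longrightarrow> (\<lambda>n. (\<Delta> n <#> x n) \<inter> G) = x"
    by (rule ext) (rule Mod_inverse(3)[OF odometer_setD(1)])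
  moreover have "\<And>y. y \<in> odometer_set H \<Delta> \<Longrightarrow> (\<lambda>n. \<Delta> n <#> (y n \<inter> G)) = y"
    by (rule ext) (rule Mod_inverse(4)[OF odometer_setD(1)])
  ultimately show "homeomorphic_maps (odometer_topology G' \<Gamma>) (odometer_topology H \<Delta>)
     (\<lambda>x n. \<Delta> n <#> x n) (\<lambda>y n. y n \<inter> G)"
    unfolding homeomorphic_maps_def topspace_odometer
    by (intro conjI ballI continuous_map_odometer odometer_maps Mod_inverse)
next
  fix g assume "g \<in> carrier (odometer G' \<Gamma>)"
  then have g: "g \<in> odometer_set G' \<Gamma>" by (simp add: odometer_def)
  have "(\<lambda>n. \<Delta> n <#> left_translation (odometer G' \<Gamma>) g z n) =
      left_translation (odometer H \<Delta>) (\<lambda>n. \<Delta> n <#> g n) (\<lambda>n. \<Delta> n <#> z n)"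
    if z: "z \<in> odometer_set G' \<Gamma>" for z
    unfolding left_translation_odometer[OF z] left_translation_odometer[OF odometer_maps(1)[OF z]]
      set_mult_G' Mod_mult[OF odometer_setD(1)[OF g] odometer_setD(1)[OF z]] by (rule refl)
  moreover have "(\<lambda>n. \<Delta> n <#> g n) \<in> carrier (odometer H \<Delta>)"
    using odometer_maps(1)[OF g] by (simp add: odometer_def)
  ultimately show "\<exists>g'\<in>carrier (odometer H \<Delta>). \<forall>z\<in>odometer_set G' \<Gamma>.
      (\<lambda>n. \<Delta> n <#> left_translation (odometer G' \<Gamma>) g z n) =
      left_translation (odometer H \<Delta>) g' (\<lambda>n. \<Delta> n <#> z n)"
    by blast
next
  fix g assume "g \<in> carrier (odometer H \<Delta>)"
  then have g: "g \<in> odometer_set H \<Delta>" by (simp add: odometer_def)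
  have "(\<lambda>n. left_translation (odometer H \<Delta>) g z n \<inter> G) =
      left_translation (odometer G' \<Gamma>) (\<lambda>n. g n \<inter> G) (\<lambda>n. z n \<inter> G)"
    if z: "z \<in> odometer_set H \<Delta>" for z
    unfolding left_translation_odometer[OF z] left_translation_odometer[OF odometer_maps(2)[OF z]]
      set_mult_G' Mod_mult'[OF odometer_setD(1)[OF g] odometer_setD(1)[OF z]] by (rule refl)
  moreover have "(\<lambda>n. g n \<inter> G) \<in> carrier (odometer G' \<Gamma>)"
    using odometer_maps(2)[OF g] by (simp add: odometer_def)
  ultimately show "\<exists>g'\<in>carrier (odometer G' \<Gamma>). \<forall>z\<in>odometer_set H \<Delta>.
      (\<lambda>n. left_translation (odometer H \<Delta>) g z n \<inter> G) =
      left_translation (odometer G' \<Gamma>) g' (\<lambda>n. z n \<inter> G)"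
    by blast
qed

end

section \<open>Transport of group properties and scales along isomorphisms\<close>

lemma finitely_generated_iso:
  assumes "group G" "group H" "f \<in> iso G H" "finitely_generated G"
  shows "finitely_generated H"
proof -
  interpret group_hom G H f
    using assms by (simp add: group_hom_def group_hom_axioms_def iso_def)
  obtain S where S: "finite S" "S \<subseteq> carrier G" "generate G S = carrier G"
    using assms(4) unfolding finitely_generated_def by blast
  have im: "f ` carrier G = carrier H"
    using assms(3) by (simp add: iso_def bij_betw_def)
  then have "generate H (f ` S) = carrier H" using generate_img[OF S(2)] S(3) by simp
  moreover have "finite (f ` S)" "f ` S \<subseteq> carrier H" using S im by auto
  ultimately show ?thesis unfolding finitely_generated_def by blast
qed

lemma amenable_iso:
  assumes "group G" "group H" "f \<in> iso G H" "amenable G"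
  shows "amenable H"
proof -
  obtain \<mu> :: "'a set \<Rightarrow> real" where m: "\<mu> (carrier G) = 1 \<and>
        (\<forall>A. A \<subseteq> carrier G \<longrightarrow> 0 \<le> \<mu> A) \<and>
        (\<forall>A B. A \<subseteq> carrier G \<longrightarrow> B \<subseteq> carrier G \<longrightarrow> A \<inter> B = {} \<longrightarrow> \<mu> (A \<union> B) = \<mu> A + \<mu> B) \<and>
        (\<forall>g \<in> carrier G. \<forall>A. A \<subseteq> carrier G \<longrightarrow> \<mu> (g <#\<^bsub>G\<^esub> A) = \<mu> A)"
    using assms(4) unfolding amenable_def by (rule exE)
  have bij: "bij_betw f (carrier G) (carrier H)" and hom: "f \<in> hom G H"
    using assms(3) by (simp_all add: iso_def)
  \<comment> \<open>The mean on \<open>H\<close> will be \<open>A \<mapsto> \<mu> (p A)\<close>, the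
    push-forward of \<open>\<mu>\<close> along \<open>f\<close>.\<close>
  define p where "p A = {x \<in> carrier G. f x \<in> A}" for A
  have pc: "p A \<subseteq> carrier G" for A by (auto simp: p_def)
  have "p (carrier H) = carrier G"
    using bij by (auto simp: p_def bij_betw_def)
  moreover have "p (A \<union> B) = p A \<union> p B" for A B by (auto simp: p_def)
  moreover have "A \<inter> B = {} \<Longrightarrow> p A \<inter> p B = {}" for A B by (auto simp: p_def)
  moreover have "\<mu> (p (h <#\<^bsub>H\<^esub> A)) = \<mu> (p A)" if h: "h \<in> carrier H" and A: "A \<subseteq> carrier H" for h A
  proof -
    obtain g where g: "g \<in> carrier G" "h = f g" using h bij by (auto simp: bij_betw_def)
    have "p (h <#\<^bsub>H\<^esub> A) = g <#\<^bsub>G\<^esub> p A"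
    proof
      show "p (h <#\<^bsub>H\<^esub> A) \<subseteq> g <#\<^bsub>G\<^esub> p A"
      proof
        fix x assume "x \<in> p (h <#\<^bsub>H\<^esub> A)"
        then obtain a where a: "x \<in> carrier G" "a \<in> A" "f x = h \<otimes>\<^bsub>H\<^esub> a"
          by (auto simp: p_def l_coset_def)
        obtain b where b: "b \<in> carrier G" "a = f b" using a A bij by (auto simp: bij_betw_def)
        have "f x = f (g \<otimes>\<^bsub>G\<^esub> b)" using a b g hom by (simp add: hom_mult)
        moreover have "g \<otimes>\<^bsub>G\<^esub> b \<in> carrier G"
          using \<open>group G\<close> g b by (simp add: group.is_monoid monoid.m_closed)
        ultimately have "x = g \<otimes>\<^bsub>G\<^esub> b" using a(1) bij by (auto simp: bij_betw_def dest: inj_onD)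
        then show "x \<in> g <#\<^bsub>G\<^esub> p A" using a b by (auto simp: p_def l_coset_def)
      qed
      show "g <#\<^bsub>G\<^esub> p A \<subseteq> p (h <#\<^bsub>H\<^esub> A)"
        using g hom \<open>group G\<close>
        by (auto simp: p_def l_coset_def hom_mult group.is_monoid monoid.m_closed)
    qed
    then show ?thesis using m g(1) pc by simp
  qed
  ultimately show ?thesis
    unfolding amenable_def using m pc by (intro exI[of _ "\<lambda>A. \<mu> (p A)"]) simp
qed

lemma residually_finite_if_scale:
  assumes "subgroup_scale G \<Gamma>" shows "residually_finite G"
  unfolding residually_finite_def
proof
  fix g assume "g \<in> carrier G - {\<one>\<^bsub>G\<^esub>}"
  then have "g \<notin> (\<Inter>n. \<Gamma> n)" using assms by (auto simp: subgroup_scale_def)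
  then obtain n where "g \<notin> \<Gamma> n" by blast
  then show "\<exists>N. finite_index_normal N G \<and> g \<notin> N"
    using assms by (auto simp: subgroup_scale_def)
qed

lemma subgroup_scale_iso:
  assumes "group G" "group H" and f: "f \<in> iso G H" and \<Gamma>: "subgroup_scale G \<Gamma>"
  shows "subgroup_scale H (\<lambda>n. f ` \<Gamma> n)"
proof -
  interpret group_hom G H f
    using assms by (simp add: group_hom_def group_hom_axioms_def iso_def)
  have inj: "inj_on f (carrier G)" and im: "f ` carrier G = carrier H"
    using f by (simp_all add: iso_def bij_betw_def)
  have N: "\<Gamma> n \<lhd> G" "finite (carrier (G Mod \<Gamma> n))" for n
    using \<Gamma> by (auto simp: subgroup_scale_def finite_index_normal_def)
  have sub: "\<Gamma> n \<subseteq> carrier G" for n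
    using normal_imp_subgroup[OF N(1)] by (rule subgroup.subset)
  have "carrier (H Mod f ` \<Gamma> n) \<subseteq> (`) f ` carrier (G Mod \<Gamma> n)" for n
  proof
    fix C assume "C \<in> carrier (H Mod f ` \<Gamma> n)"
    then obtain g where g: "g \<in> carrier G" "C = f ` \<Gamma> n #>\<^bsub>H\<^esub> f g"
      unfolding carrier_FactGroup im[symmetric] by auto
    have "C = f ` (\<Gamma> n #>\<^bsub>G\<^esub> g)"
      using g sub[of n] by (auto simp: r_coset_def image_iff subset_iff)
    then show "C \<in> (`) f ` carrier (G Mod \<Gamma> n)"
      using g by (auto simp: carrier_FactGroup)
  qed
  then have "finite (carrier (H Mod f ` \<Gamma> n))" for n
    using N(2) finite_surj by metis
  moreover have "f ` \<Gamma> n \<lhd> H" for n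
    by (rule iso_normal_subgroup[OF f \<open>group G\<close> \<open>group H\<close> N(1)])
  moreover have "f ` \<Gamma> (Suc n) \<subseteq> f ` \<Gamma> n" for n
    using \<Gamma> by (auto simp: subgroup_scale_def)
  moreover have "(\<Inter>n. f ` \<Gamma> n) = {\<one>\<^bsub>H\<^esub>}"
  proof -
    have "(\<Inter>n. f ` \<Gamma> n) = f ` (\<Inter>n. \<Gamma> n)"
      using inj sub by (subst image_INT[of f "carrier G"]) auto
    then show ?thesis using \<Gamma> by (simp add: subgroup_scale_def)
  qed
  ultimately show ?thesis
    by (simp add: subgroup_scale_def finite_index_normal_def)
qed

text \<open>The groups constructed below consist of permutations, whereas the theorem asks for
  groups on \<open>nat\<close>. A countable \<open>H\<close> is copied there along an injection, and
  \<open>G\<close> and the scale are carried along as images.\<close>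

lemma odometer_full_groups_on_nat:
  fixes H :: "'a monoid" and G :: "'a set" and \<Delta> :: "nat \<Rightarrow> 'a set"
  assumes "group H" and "countable (carrier H)" and G: "subgroup G H" and scale: "subgroup_scale H \<Delta>"
    and dense: "\<And>n h. h \<in> carrier H \<Longrightarrow> \<exists>g\<in>G. h \<in> \<Delta> n #>\<^bsub>H\<^esub> g"
    and fg: "finitely_generated (H\<lparr>carrier := G\<rparr>)" "finitely_generated H"
    and am: "amenable (H\<lparr>carrier := G\<rparr>)" "\<not> amenable H"
  shows "\<exists>(G :: nat monoid) (H :: nat monoid) (\<Gamma> :: nat \<Rightarrow> nat set) (\<Delta> :: nat \<Rightarrow> nat set).
    Group.group G \<and> finitely_generated G \<and> residually_finite G \<and> amenable G \<and>
    Group.group H \<and> finitely_generated H \<and> residually_finite H \<and> \<not> amenable H \<and>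
    subgroup_scale G \<Gamma> \<and> subgroup_scale H \<Delta> \<and>
    odometer_full_group G \<Gamma> \<cong> odometer_full_group H \<Delta>"
proof -
  interpret H: group H by (rule assms(1))
  define f where "f = to_nat_on (carrier H)"
  have inj: "inj_on f (carrier H)"
    unfolding f_def by (rule inj_on_to_nat_on) fact
  define e where "e = inv_into (carrier H) f"
  define H' where "H' = \<lparr>carrier = f ` carrier H, mult = \<lambda>x y. f (e x \<otimes>\<^bsub>H\<^esub> e y), one = f \<one>\<^bsub>H\<^esub>\<rparr>"
  have ef: "e (f x) = x" if "x \<in> carrier H" for x
    unfolding e_def using inj that by simp
  have im: "carrier H' = f ` carrier H" by (simp add: H'_def)
  have iso: "f \<in> iso H H'"
    using inj by (auto simp: iso_def hom_def H'_def bij_betw_def ef)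
  have "group (H'\<lparr>one := f \<one>\<^bsub>H\<^esub>\<rparr>)" by (rule H.iso_imp_img_group[OF iso])
  then have grp: "group H'" by (simp add: H'_def)
  interpret f: group_hom H H' f
    using \<open>group H\<close> grp iso by (simp add: group_hom_def group_hom_axioms_def iso_def)
  let ?G = "f ` G" and ?\<Delta> = "\<lambda>n. f ` \<Delta> n"
  have Gc: "G \<subseteq> carrier H" using G by (rule subgroup.subset)
  have sub: "subgroup ?G H'" using G by (rule f.subgroup_img_is_subgroup)
  have scale': "subgroup_scale H' ?\<Delta>" by (rule subgroup_scale_iso[OF \<open>group H\<close> grp iso scale])
  note sc = scale'[unfolded subgroup_scale_def finite_index_normal_def]
  have norm': "f ` \<Delta> n \<lhd> H'" for n
    by (rule sc[THEN conjunct1, THEN spec, THEN conjunct1])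
  have decr': "f ` \<Delta> (Suc n) \<subseteq> f ` \<Delta> n" for n
    by (rule sc[THEN conjunct2, THEN conjunct1, THEN spec])
  have dense': "\<exists>g\<in>f ` G. h \<in> f ` \<Delta> n #>\<^bsub>H'\<^esub> g" if h: "h \<in> carrier H'" for n h
  proof -
    obtain x where x: "x \<in> carrier H" "h = f x" using h unfolding im by blast
    obtain g where g: "g \<in> G" "x \<in> \<Delta> n #>\<^bsub>H\<^esub> g" using dense[OF x(1), of n] by blast
    then obtain d where d: "d \<in> \<Delta> n" "x = d \<otimes>\<^bsub>H\<^esub> g" unfolding r_coset_def by blast
    have "\<Delta> n \<lhd> H" using scale by (simp add: subgroup_scale_def finite_index_normal_def)
    then have "\<Delta> n \<subseteq> carrier H" by (intro subgroup.subset normal_imp_subgroup)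
    then have "h = f d \<otimes>\<^bsub>H'\<^esub> f g"
      unfolding x(2) d(2) using d(1) g(1) Gc by (intro f.hom_mult) blast+
    then show "\<exists>g\<in>f ` G. h \<in> f ` \<Delta> n #>\<^bsub>H'\<^esub> g"
      using g(1) d(1) unfolding r_coset_def by blast
  qed
  interpret D: dense_subgroup H' ?G ?\<Delta>
    by (intro dense_subgroup.intro dense_subgroup_axioms.intro grp sub norm' decr' dense')
  have G_grp: "group (H\<lparr>carrier := G\<rparr>)" "group D.G'"
    using subgroup.subgroup_is_group[OF G \<open>group H\<close>] subgroup.subgroup_is_group[OF sub grp] by auto
  have isoG: "f \<in> iso (H\<lparr>carrier := G\<rparr>) D.G'"
    using inj Gc by (auto simp: iso_def hom_def bij_betw_def subset_iff intro: inj_on_subset)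
  have "subgroup_scale D.G' D.\<Gamma>"
    unfolding subgroup_scale_def
  proof (intro conjI allI)
    show "finite_index_normal (D.\<Gamma> n) D.G'" for n
      using scale' by (intro D.finite_index_\<Gamma>) (simp add: subgroup_scale_def)
    show "D.\<Gamma> (Suc n) \<subseteq> D.\<Gamma> n" for n using decr' by (auto simp: D.\<Gamma>_def)
    have "(\<Inter>n. D.\<Gamma> n) = ?G \<inter> (\<Inter>n. ?\<Delta> n)" by (auto simp: D.\<Gamma>_def)
    then show "(\<Inter>n. D.\<Gamma> n) = {\<one>\<^bsub>D.G'\<^esub>}"
      using scale' subgroup.one_closed[OF sub] by (auto simp: subgroup_scale_def)
  qed
  moreover have "\<not> amenable H'"
  proof
    assume "amenable H'"
    then have "amenable H" by (rule amenable_iso[OF grp \<open>group H\<close> H.iso_set_sym[OF iso]])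
    then show False using am(2) by contradiction
  qed
  ultimately show ?thesis
    using G_grp grp scale' finitely_generated_iso[OF G_grp isoG fg(1)]
      finitely_generated_iso[OF \<open>group H\<close> grp iso fg(2)] amenable_iso[OF G_grp isoG am(1)]
      residually_finite_if_scale D.odometer_full_group_iso
    by (intro exI[of _ D.G'] exI[of _ H'] exI[of _ D.\<Gamma>] exI[of _ ?\<Delta>] conjI)
qed

section \<open>Amenability criteria\<close>

text \<open>Set functions with values in the unit interval form a compact space by Tychonoff. Finite
  additivity together with \<open>\<epsilon>\<close>-invariance under a finite \<open>S\<close> is a
  closed condition, satisfied by the normalised counting measure of a Foelner set. The finite
  intersection property then yields an invariant mean.\<close>

lemma amenable_if_Folner:
  fixes G (structure)
  assumes "group G"
    and Folner: "\<And>S \<epsilon>. finite S \<Longrightarrow> S \<subseteq> carrier G \<Longrightarrow> \<epsilon> > 0 \<Longrightarrow>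
      \<exists>F. finite F \<and> F \<noteq> {} \<and> F \<subseteq> carrier G \<and>
        (\<forall>g\<in>S. real (card {x\<in>F. g \<otimes> x \<notin> F}) \<le> \<epsilon> * real (card F))"
  shows "amenable G"
proof -
  interpret group G by fact
  define U :: "('a set \<Rightarrow> real) set" where "U = PiE UNIV (\<lambda>_. {0..1})"
  have U: "compact U"
    unfolding U_def compactin_euclidean_iff[symmetric] euclidean_product_topology[symmetric]
      compactin_PiE by simp
  define I where "I = {(S, \<epsilon>::real). finite S \<and> S \<subseteq> carrier G \<and> \<epsilon> > 0}"
  \<comment> \<open>Only the upper bound on \<open>\<mu> (g <# A)\<close> is imposed: for the limit
    mean, the reverse inequality follows from the bound for \<open>inv g\<close> and the set
    \<open>g <# A\<close>.\<close>
  define C where "C = (\<lambda>(S, \<epsilon>). {\<mu> :: 'a set \<Rightarrow> real. \<mu> (carrier G) = 1}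
      \<inter> (\<Inter>A\<in>Pow (carrier G). \<Inter>B\<in>{B. B \<subseteq> carrier G \<and> A \<inter> B = {}}. {\<mu>. \<mu> (A \<union> B) = \<mu> A + \<mu> B})
      \<inter> (\<Inter>g\<in>S. \<Inter>A\<in>Pow (carrier G). {\<mu>. \<mu> (g <# A) \<le> \<mu> A + \<epsilon>}))"
  have cont: "continuous_on UNIV (\<lambda>\<mu> :: 'a set \<Rightarrow> real. \<mu> A)" for A
    by (rule continuous_on_product_coordinates)
  have closed: "closed (C i)" for i
    unfolding C_def case_prod_beta
    by (intro closed_Int closed_INT ballI closed_Collect_eq closed_Collect_le continuous_intros cont)
  have C_iff: "\<mu> \<in> C (S, \<epsilon>) \<longleftrightarrow> \<mu> (carrier G) = 1 \<and>
      (\<forall>A B. A \<subseteq> carrier G \<longrightarrow> B \<subseteq> carrier G \<longrightarrow> A \<inter> B = {} \<longrightarrow> \<mu> (A \<union> B) = \<mu> A + \<mu> B) \<and>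
      (\<forall>g\<in>S. \<forall>A. A \<subseteq> carrier G \<longrightarrow> \<mu> (g <# A) \<le> \<mu> A + \<epsilon>)" for \<mu> S \<epsilon>
    unfolding C_def by (simp only: prod.case Int_iff INT_iff Pow_iff mem_Collect_eq Ball_def) blast
  have mono: "C (S, \<epsilon>) \<subseteq> C (S', \<epsilon>')" if "S' \<subseteq> S" "\<epsilon> \<le> \<epsilon>'" for S S' and \<epsilon> \<epsilon>' :: real
  proof
    fix \<mu> assume \<mu>: "\<mu> \<in> C (S, \<epsilon>)"
    have "\<mu> (g <# A) \<le> \<mu> A + \<epsilon>'" if "g \<in> S'" "A \<subseteq> carrier G" for g A
    proof -
      have "\<mu> (g <# A) \<le> \<mu> A + \<epsilon>" using \<mu> that \<open>S' \<subseteq> S\<close> unfolding C_iff by blast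
      then show ?thesis using \<open>\<epsilon> \<le> \<epsilon>'\<close> by simp
    qed
    then have "\<forall>g\<in>S'. \<forall>A. A \<subseteq> carrier G \<longrightarrow> \<mu> (g <# A) \<le> \<mu> A + \<epsilon>'" by simp
    with \<mu> show "\<mu> \<in> C (S', \<epsilon>')" unfolding C_iff by (elim conjE) (intro conjI)
  qed
  have ne: "U \<inter> C (S, \<epsilon>) \<noteq> {}" if S: "finite S" "S \<subseteq> carrier G" and "\<epsilon> > 0" for S \<epsilon>
  proof -
    \<comment> \<open>A point of \<open>(g <# A) \<inter> F\<close> that is not \<open>g\<close>
      times a point of \<open>A \<inter> F\<close> is an \<open>x\<close> in \<open>F\<close> with
      \<open>inv g \<otimes> x\<close> outside \<open>F\<close>; hence the Foelner condition is used
      for the inverses.\<close>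
    have "finite (m_inv G ` S)" "m_inv G ` S \<subseteq> carrier G" using S by auto
    from Folner[OF this \<open>\<epsilon> > 0\<close>] obtain F where F: "finite F" "F \<noteq> {}" "F \<subseteq> carrier G"
      "\<And>g. g \<in> S \<Longrightarrow> real (card {x\<in>F. inv g \<otimes> x \<notin> F}) \<le> \<epsilon> * real (card F)" by auto
    have cF: "real (card F) > 0" using F by (simp add: card_gt_0_iff)
    define \<mu> where "\<mu> A = real (card (A \<inter> F)) / real (card F)" for A
    have "\<mu> \<in> U"
      unfolding U_def \<mu>_def using F(1) cF by (auto simp: divide_le_eq card_mono)
    moreover have "\<mu> (carrier G) = 1"
      using F cF by (simp add: \<mu>_def Int_absorb1)
    moreover have "\<mu> (A \<union> B) = \<mu> A + \<mu> B" if "A \<inter> B = {}" for A B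
    proof -
      have "(A \<union> B) \<inter> F = (A \<inter> F) \<union> (B \<inter> F)" "(A \<inter> F) \<inter> (B \<inter> F) = {}" using that by auto
      then show ?thesis
        using F(1) by (simp add: \<mu>_def card_Un_disjoint add_divide_distrib)
    qed
    moreover have "\<mu> (g <# A) \<le> \<mu> A + \<epsilon>" if g: "g \<in> S" and A: "A \<subseteq> carrier G" for g A
    proof -
      have gc: "g \<in> carrier G" using g S by auto
      let ?B = "{x\<in>F. inv g \<otimes> x \<notin> F}"
      have "(g <# A) \<inter> F \<subseteq> (\<lambda>x. g \<otimes> x) ` (A \<inter> F) \<union> ?B"
      proof
        fix x assume x: "x \<in> (g <# A) \<inter> F"
        then obtain a where a: "a \<in> A" "x = g \<otimes> a" by (auto simp: l_coset_def)
        then have "inv g \<otimes> x = a" using gc A by (simp add: inv_solve_left' subset_iff)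
        then show "x \<in> (\<lambda>x. g \<otimes> x) ` (A \<inter> F) \<union> ?B" using a x by auto
      qed
      then have "card ((g <# A) \<inter> F) \<le> card ((\<lambda>x. g \<otimes> x) ` (A \<inter> F) \<union> ?B)"
        using F(1) by (intro card_mono) auto
      also have "\<dots> \<le> card ((\<lambda>x. g \<otimes> x) ` (A \<inter> F)) + card ?B" by (rule card_Un_le)
      also have "card ((\<lambda>x. g \<otimes> x) ` (A \<inter> F)) \<le> card (A \<inter> F)" using F(1) by (intro card_image_le) simp
      finally have "real (card ((g <# A) \<inter> F)) \<le> real (card (A \<inter> F)) + real (card ?B)" by simp
      then have "real (card ((g <# A) \<inter> F)) \<le> real (card (A \<inter> F)) + \<epsilon> * real (card F)"
        using F(4)[OF g] by simp
      then show ?thesis using cF by (simp add: \<mu>_def divide_simps)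
    qed
    ultimately have "\<mu> \<in> U \<inter> C (S, \<epsilon>)"
      unfolding C_iff Int_iff by (intro conjI allI ballI impI)
    then show ?thesis by blast
  qed
  have "U \<inter> \<Inter> (C ` I) \<noteq> {}"
  proof (rule compact_imp_fip_image[OF U closed])
    fix J assume J: "finite J" "J \<subseteq> I"
    \<comment> \<open>The inserted \<open>1\<close> provides a positive value when \<open>J\<close>
      is empty.\<close>
    define \<epsilon> where "\<epsilon> = Min (insert 1 (snd ` J))"
    have "\<epsilon> > 0" unfolding \<epsilon>_def using J by (subst Min_gr_iff) (auto simp: I_def)
    moreover have "finite (fst j) \<and> fst j \<subseteq> carrier G" if "j \<in> J" for j
      using subsetD[OF J(2) that] unfolding I_def by (simp add: case_prod_beta)
    then have "finite (\<Union>(fst ` J))" "\<Union>(fst ` J) \<subseteq> carrier G" using J(1) by blast+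
    ultimately have "U \<inter> C (\<Union>(fst ` J), \<epsilon>) \<noteq> {}" by (intro ne)
    moreover have "C (\<Union>(fst ` J), \<epsilon>) \<subseteq> \<Inter> (C ` J)"
    proof (rule INT_greatest)
      fix j assume "j \<in> J"
      then have "C (\<Union>(fst ` J), \<epsilon>) \<subseteq> C (fst j, snd j)"
        using J(1) by (intro mono) (auto simp: \<epsilon>_def intro!: Min_le)
      then show "C (\<Union>(fst ` J), \<epsilon>) \<subseteq> C j" by simp
    qed
    ultimately show "U \<inter> \<Inter> (C ` J) \<noteq> {}" by blast
  qed
  then obtain \<mu> where \<mu>: "\<mu> \<in> U" "\<And>S \<epsilon>. finite S \<Longrightarrow> S \<subseteq> carrier G \<Longrightarrow> \<epsilon> > 0 \<Longrightarrow> \<mu> \<in> C (S, \<epsilon>)"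
    unfolding I_def by blast
  have \<mu>0: "\<mu> \<in> C ({}, 1)" by (rule \<mu>(2)) auto
  have le: "\<mu> (g <# A) \<le> \<mu> A" if "g \<in> carrier G" "A \<subseteq> carrier G" for g A
  proof (rule field_le_epsilon)
    fix \<epsilon> :: real assume "\<epsilon> > 0"
    then have "\<mu> \<in> C ({g}, \<epsilon>)" using that by (intro \<mu>(2)) auto
    then show "\<mu> (g <# A) \<le> \<mu> A + \<epsilon>" using that unfolding C_iff by blast
  qed
  have "\<mu> (g <# A) = \<mu> A" if gA: "g \<in> carrier G" "A \<subseteq> carrier G" for g A
  proof (rule antisym[OF le[OF gA]])
    have "inv g <# (g <# A) = A" using gA by (simp add: lcos_m_assoc lcos_mult_one)
    then show "\<mu> A \<le> \<mu> (g <# A)"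
      using le[of "inv g" "g <# A"] gA by (simp add: l_coset_subset_G)
  qed
  moreover have "0 \<le> \<mu> A" for A using \<mu>(1) by (auto simp: U_def)
  ultimately show ?thesis
    unfolding amenable_def using \<mu>0 unfolding C_iff
    by (intro exI[of _ \<mu>]) (elim conjE, intro conjI allI ballI impI, simp_all)
qed

text \<open>The hypotheses describe \<open>G\<close> as an extension of the locally finite group
  \<open>N\<close> by the infinite cyclic group generated by the image of \<open>t\<close>. The
  Foelner sets are unions of \<open>n\<close> consecutive blocks \<open>t [^] j \<otimes> K\<close>,
  where \<open>K\<close> is a finite subgroup of \<open>N\<close>.\<close>

lemma amenable_locally_finite_by_int:
  fixes G (structure) and t :: 'a
  assumes "N \<lhd> G" and t: "t \<in> carrier G"
    and decomp: "\<And>g. g \<in> carrier G \<Longrightarrow> \<exists>k::int. t [^] k \<otimes> g \<in> N"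
    and free: "\<And>k::int. t [^] k \<in> N \<Longrightarrow> k = 0"
    and locally_finite: "\<And>S. finite S \<Longrightarrow> S \<subseteq> N \<Longrightarrow> \<exists>K. finite K \<and> subgroup K G \<and> S \<subseteq> K \<and> K \<subseteq> N"
  shows "amenable G"
proof -
  interpret N: normal N G by fact
  have tc: "t [^] (k::int) \<in> carrier G" for k using t by simp
  show ?thesis
  proof (rule amenable_if_Folner)
    show "group G" by (rule N.is_group)
    fix S :: "'a set" and \<epsilon> :: real
    assume S: "finite S" "S \<subseteq> carrier G" and e: "\<epsilon> > 0"
    obtain \<kappa> where \<kappa>: "\<And>g. g \<in> carrier G \<Longrightarrow> t [^] (- \<kappa> g :: int) \<otimes> g \<in> N"
    proof -
      have "\<exists>k. t [^] (- k :: int) \<otimes> g \<in> N" if "g \<in> carrier G" for g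
        using decomp[OF that] by (metis minus_minus)
      then show ?thesis using that by metis
    qed
    \<comment> \<open>\<open>M\<close> bounds \<open>\<bar>\<kappa> g\<bar>\<close> for all
      \<open>g \<in> S\<close>, and \<open>n\<close> is taken so large that the loss of
      \<open>M\<close> out of \<open>n\<close> blocks is at most the proportion
      \<open>\<epsilon>\<close>.\<close>
    define M where "M = (\<Sum>g\<in>S. \<bar>\<kappa> g\<bar>)"
    have M: "\<bar>\<kappa> g\<bar> \<le> M" if "g \<in> S" for g
      unfolding M_def using S(1) that by (intro member_le_sum) auto
    obtain n :: nat where n: "real_of_int M / \<epsilon> < real n" "n > 0"
      using reals_Archimedean2[of "max 0 (real_of_int M / \<epsilon>)"] by auto
    have Mn: "real_of_int M \<le> \<epsilon> * real n" using n(1) e by (simp add: divide_simps mult.commute)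
    let ?J = "{0..<int n}"
    \<comment> \<open>Chosen so that \<open>g \<otimes> t [^] j = t [^] (j + \<kappa> g) \<otimes> b
      (g, j)\<close>. As soon as \<open>K\<close> contains these finitely many elements of
      \<open>N\<close>, left multiplication by \<open>g\<close> respects the blocks.\<close>
    define b where "b = (\<lambda>(g, j). t [^] (- \<kappa> g - j) \<otimes> g \<otimes> t [^] j)"
    have b_in: "b (g, j) \<in> N" if "g \<in> carrier G" for g j
    proof -
      have "t [^] (- j) \<otimes> (t [^] (- \<kappa> g) \<otimes> g) \<otimes> t [^] j \<in> N"
        using N.inv_op_closed1[OF tc[of j] \<kappa>[OF that]] t by (simp add: N.int_pow_neg)
      also have "t [^] (- j) \<otimes> (t [^] (- \<kappa> g) \<otimes> g) = t [^] (- \<kappa> g - j) \<otimes> g"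
      proof -
        have "- j + - \<kappa> g = - \<kappa> g - j" by simp
        with N.int_pow_mult[OF t, of "- j" "- \<kappa> g"] that t show ?thesis
          by (simp only: N.m_assoc[symmetric] N.int_pow_closed)
      qed
      finally show ?thesis by (simp add: b_def)
    qed
    have "finite (b ` (S \<times> ?J))" "b ` (S \<times> ?J) \<subseteq> N"
      using S b_in by auto
    from locally_finite[OF this] obtain K where K: "finite K" "subgroup K G" "K \<subseteq> N"
      "\<And>g j. g \<in> S \<Longrightarrow> j \<in> ?J \<Longrightarrow> b (g, j) \<in> K" by blast
    have Kc: "k \<in> carrier G" if "k \<in> K" for k using K(2) that by (rule subgroup.mem_carrier)
    define f where "f = (\<lambda>(j::int, k). t [^] j \<otimes> k)"
    \<comment> \<open>Distinct powers of \<open>t\<close> lie in distinct cosets of \<open>N\<close>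
      by \<open>free\<close>, so the blocks are disjoint and \<open>F\<close> has exactly
      \<open>n * card K\<close> elements.\<close>
    have inj: "inj_on f (UNIV \<times> K)"
    proof (rule inj_onI, clarify)
      fix j j' k k' assume k: "k \<in> K" "k' \<in> K" and "f (j, k) = f (j', k')"
      then have e: "t [^] j \<otimes> k = t [^] j' \<otimes> k'" by (simp add: f_def)
      have "t [^] (- j' + j) \<otimes> k = t [^] (- j') \<otimes> (t [^] j \<otimes> k)"
        unfolding N.int_pow_mult[OF t] using t Kc k by (simp add: N.m_assoc)
      also have "\<dots> = k'"
        unfolding e using t Kc k by (simp add: N.int_pow_neg N.inv_solve_left')
      finally have "t [^] (- j' + j) = k' \<otimes> inv k" using Kc k tc by (simp add: N.inv_solve_right)
      then have "t [^] (- j' + j) \<in> N" using k K by (metis subgroup.m_closed subgroup.m_inv_closed subsetD)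
      then have "j = j'" using free by force
      with e show "j = j' \<and> k = k'" using t Kc k by simp
    qed
    \<comment> \<open>\<open>g\<close> maps \<open>t\<^sup>j K\<close> onto \<open>t\<^bsup>j + \<kappa> g\<^esup> K\<close>, so it moves at most \<open>\<bar>\<kappa> g\<bar>\<close> of the \<open>n\<close> blocks of \<open>F\<close> out of \<open>F\<close>\<close>
    define F where "F = f ` (?J \<times> K)"
    have "card F = card (?J \<times> K)"
      unfolding F_def using inj by (intro card_image) (auto intro: inj_on_subset)
    then have cF: "card F = n * card K" by (simp add: card_cartesian_product)
    have "real (card {x\<in>F. g \<otimes> x \<notin> F}) \<le> \<epsilon> * real (card F)" if g: "g \<in> S" for g
    proof -
      have gc: "g \<in> carrier G" using g S by auto
      let ?B = "{j\<in>?J. j + \<kappa> g \<notin> ?J}"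
      have "{x\<in>F. g \<otimes> x \<notin> F} \<subseteq> f ` (?B \<times> K)"
      proof
        fix x assume x: "x \<in> {x\<in>F. g \<otimes> x \<notin> F}"
        then obtain j k where jk: "j \<in> ?J" "k \<in> K" "x = f (j, k)" by (auto simp: F_def)
        have "t [^] (j + \<kappa> g) \<otimes> b (g, j) = t [^] (j + \<kappa> g) \<otimes> t [^] (- \<kappa> g - j) \<otimes> g \<otimes> t [^] j"
          using gc t by (simp add: b_def N.m_assoc)
        also have "\<dots> = g \<otimes> t [^] j"
          using gc t by (simp add: N.int_pow_mult[symmetric])
        finally have "g \<otimes> x = f (j + \<kappa> g, b (g, j) \<otimes> k)"
          using gc t Kc jk K(4)[OF g jk(1)] by (simp add: f_def N.m_assoc[symmetric])
        moreover have "b (g, j) \<otimes> k \<in> K" using K(2,4) g jk subgroup.m_closed by metis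
        ultimately have "j + \<kappa> g \<notin> ?J" using x by (auto simp: F_def)
        then show "x \<in> f ` (?B \<times> K)" using jk by blast
      qed
      moreover have "finite ?B" by (rule finite_subset[of _ ?J]) auto
      then have fBK: "finite (?B \<times> K)" using K(1) by (rule finite_cartesian_product)
      ultimately have "card {x\<in>F. g \<otimes> x \<notin> F} \<le> card (f ` (?B \<times> K))"
        by (intro card_mono finite_imageI)
      also have "\<dots> \<le> card (?B \<times> K)" using fBK by (rule card_image_le)
      also have "\<dots> = card ?B * card K" by (simp add: card_cartesian_product)
      finally have 1: "card {x\<in>F. g \<otimes> x \<notin> F} \<le> card ?B * card K" .
      have "?B \<subseteq> (if \<kappa> g \<ge> 0 then {int n - \<kappa> g..<int n} else {0..<- \<kappa> g})" by auto
      then have "card ?B \<le> card (if \<kappa> g \<ge> 0 then {int n - \<kappa> g..<int n} else {0..<- \<kappa> g})"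
        by (intro card_mono) auto
      then have "int (card ?B) \<le> M" using M[OF g] by (auto split: if_splits)
      then have "real (card ?B) \<le> \<epsilon> * real n" using Mn by linarith
      then have "real (card ?B) * real (card K) \<le> \<epsilon> * real n * real (card K)"
        by (intro mult_right_mono) auto
      then show ?thesis using 1 cF by (simp add: mult.assoc flip: of_nat_mult)
    qed
    moreover have "F \<noteq> {}" using n(2) K(2) subgroup.one_closed by (fastforce simp: F_def)
    moreover have "finite F" "F \<subseteq> carrier G" using K(1) Kc t by (auto simp: F_def f_def)
    ultimately show "\<exists>F. finite F \<and> F \<noteq> {} \<and> F \<subseteq> carrier G \<and>
        (\<forall>g\<in>S. real (card {x\<in>F. g \<otimes> x \<notin> F}) \<le> \<epsilon> * real (card F))" by blast
  qed
qed

section \<open>Words in involutions and a paradoxical decomposition\<close>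

context group begin

definition word_prod :: "('i \<Rightarrow> 'a) \<Rightarrow> 'i list \<Rightarrow> 'a" where
  "word_prod s w = foldr (\<lambda>i x. s i \<otimes> x) w \<one>"

lemma word_prod_simps [simp]:
  "word_prod s [] = \<one>" "word_prod s (i # w) = s i \<otimes> word_prod s w"
  by (simp_all add: word_prod_def)

lemma word_prod_closed: "range s \<subseteq> carrier G \<Longrightarrow> word_prod s w \<in> carrier G"
  by (induction w) auto

lemma word_prod_append:
  "range s \<subseteq> carrier G \<Longrightarrow> word_prod s (v @ w) = word_prod s v \<otimes> word_prod s w"
  by (induction v) (auto simp: word_prod_closed m_assoc range_subsetD)

lemma word_prod_rev:
  assumes s: "range s \<subseteq> carrier G" and inv: "\<And>i. s i \<otimes> s i = \<one>"
  shows "word_prod s (rev w) \<otimes> word_prod s w = \<one>"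
proof (induction w)
  case (Cons i w)
  have si: "s i \<in> carrier G" using s by auto
  have "word_prod s (rev (i # w)) \<otimes> word_prod s (i # w)
      = word_prod s (rev w) \<otimes> ((s i \<otimes> s i) \<otimes> word_prod s w)"
    using s si by (simp add: word_prod_append word_prod_closed m_assoc)
  then show ?case using Cons inv s by (simp add: word_prod_closed)
qed simp

text \<open>Equal first letters are cancelled. If the first letters differ, the reversal of one word
  followed by the other is again reduced and has value one, against freeness.\<close>

lemma word_prod_distinct_adj_inj:
  assumes s: "range s \<subseteq> carrier G" and inv: "\<And>i. s i \<otimes> s i = \<one>"
    and free: "\<And>w. distinct_adj w \<Longrightarrow> w \<noteq> [] \<Longrightarrow> word_prod s w \<noteq> \<one>"
  shows "distinct_adj v \<Longrightarrow> distinct_adj w \<Longrightarrow> word_prod s v = word_prod s w \<Longrightarrow> v = w"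
proof (induction v arbitrary: w)
  case Nil
  then show ?case using free[of w] by (cases "w = []") auto
next
  case (Cons i v)
  show ?case
  proof (cases w)
    case Nil
    then show ?thesis using Cons.prems free[of "i # v"] by simp
  next
    case w: (Cons j u)
    show ?thesis
    proof (cases "i = j")
      case True
      have "s i \<otimes> word_prod s v = s i \<otimes> word_prod s u" using Cons.prems(3) w True by simp
      then have "word_prod s v = word_prod s u"
        using range_subsetD[OF s] word_prod_closed[OF s] by simp
      moreover have "distinct_adj v" using Cons.prems(1) by (rule distinct_adj_ConsD)
      moreover have "distinct_adj u" using Cons.prems(2) unfolding w by (rule distinct_adj_ConsD)
      ultimately have "v = u" by (intro Cons.IH)
      then show ?thesis using True w by simp
    next
      case False
      have "distinct_adj (rev (i # v) @ w)"
        using Cons.prems(1,2) w False by (auto simp: distinct_adj_append_iff distinct_adj_Cons last_rev)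
      moreover have "word_prod s (rev (i # v) @ w) = \<one>"
        unfolding word_prod_append[OF s] Cons.prems(3)[symmetric] by (rule word_prod_rev[OF s inv])
      ultimately show ?thesis using free[of "rev (i # v) @ w"] by simp
    qed
  qed
qed

lemma reduce_word:
  assumes s: "range s \<subseteq> carrier G" and inv: "\<And>i. s i \<otimes> s i = \<one>"
  shows "\<exists>v. distinct_adj v \<and> word_prod s v = word_prod s w"
proof (induction w)
  case (Cons i w)
  then obtain v where v: "distinct_adj v" "word_prod s v = word_prod s w" by blast
  show ?case
  proof (cases "v = [] \<or> hd v \<noteq> i")
    case True
    then show ?thesis using v by (intro exI[of _ "i # v"]) (auto simp: distinct_adj_Cons)
  next
    case False
    then obtain u where u: "v = i # u" by (cases v) auto
    have si: "s i \<in> carrier G" using s by auto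
    have "word_prod s (i # w) = (s i \<otimes> s i) \<otimes> word_prod s u"
      using v u si word_prod_closed[OF s] by (simp add: m_assoc flip: v(2))
    then show ?thesis
      using v u inv word_prod_closed[OF s] by (intro exI[of _ u]) (auto dest: distinct_adj_ConsD)
  qed
qed (auto intro: exI[of _ "[]"])

text \<open>The involutions generate only a subgroup, so \<open>G\<close> is cut into the right
  cosets \<open>orb h\<close> of that subgroup, with a representative \<open>root h\<close> in each.
  Every element is a unique reduced word times its representative and is sorted by the first letter
  of that word. Two letters would give no contradiction, the infinite dihedral group being amenable;
  three do.\<close>

lemma not_amenable_if_free_involutions:
  fixes s :: "'i \<Rightarrow> 'a"
  assumes s: "range s \<subseteq> carrier G" and inv: "\<And>i. s i \<otimes> s i = \<one>"
    and free: "\<And>w. distinct_adj w \<Longrightarrow> w \<noteq> [] \<Longrightarrow> word_prod s w \<noteq> \<one>"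
    and abc: "distinct [a, b, c :: 'i]"
  shows "\<not> amenable G"
proof
  let ?p = "word_prod s"
  note pc = word_prod_closed[OF s]
  have sc: "s i \<in> carrier G" for i using s by auto
  assume "amenable G"
  then obtain \<mu> :: "'a set \<Rightarrow> real" where m: "\<mu> (carrier G) = 1 \<and>
        (\<forall>A. A \<subseteq> carrier G \<longrightarrow> 0 \<le> \<mu> A) \<and>
        (\<forall>A B. A \<subseteq> carrier G \<longrightarrow> B \<subseteq> carrier G \<longrightarrow> A \<inter> B = {} \<longrightarrow> \<mu> (A \<union> B) = \<mu> A + \<mu> B) \<and>
        (\<forall>g \<in> carrier G. \<forall>A. A \<subseteq> carrier G \<longrightarrow> \<mu> (g <# A) = \<mu> A)"
    unfolding amenable_def by (rule exE)
  have \<mu>: "\<mu> (carrier G) = 1"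
    "\<And>A. A \<subseteq> carrier G \<Longrightarrow> 0 \<le> \<mu> A"
    "\<And>A B. A \<subseteq> carrier G \<Longrightarrow> B \<subseteq> carrier G \<Longrightarrow> A \<inter> B = {} \<Longrightarrow> \<mu> (A \<union> B) = \<mu> A + \<mu> B"
    "\<And>g A. g \<in> carrier G \<Longrightarrow> A \<subseteq> carrier G \<Longrightarrow> \<mu> (g <# A) = \<mu> A"
    using m by simp_all
  define orb where "orb h = range (\<lambda>w. ?p w \<otimes> h)" for h
  define root where "root h = (SOME r. r \<in> orb h)" for h
  have orb_mult: "orb (s i \<otimes> h) = orb h" if h: "h \<in> carrier G" for i h
  proof -
    have 1: "orb (s i \<otimes> h) \<subseteq> orb h" if h: "h \<in> carrier G" for h
    proof
      fix x assume "x \<in> orb (s i \<otimes> h)"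
      then obtain w where "x = ?p w \<otimes> (s i \<otimes> h)" by (auto simp: orb_def)
      then have "x = ?p (w @ [i]) \<otimes> h"
        using h sc pc by (simp add: word_prod_append[OF s] m_assoc)
      then show "x \<in> orb h" by (auto simp: orb_def)
    qed
    have "s i \<otimes> (s i \<otimes> h) = h" using h sc inv by (simp flip: m_assoc)
    then show ?thesis using 1[OF h] 1[of "s i \<otimes> h"] h sc by auto
  qed
  have root: "\<exists>w. distinct_adj w \<and> h = ?p w \<otimes> root h" if h: "h \<in> carrier G" for h
  proof -
    have "?p [] \<otimes> h \<in> orb h" unfolding orb_def by (rule rangeI)
    then have "root h \<in> orb h" unfolding root_def by (rule someI)
    then obtain w where w: "root h = ?p w \<otimes> h" by (auto simp: orb_def)
    have "?p (rev w) \<otimes> root h = (?p (rev w) \<otimes> ?p w) \<otimes> h"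
      unfolding w using h pc by (simp add: m_assoc)
    also have "\<dots> = h" using h word_prod_rev[OF s inv] by simp
    finally show ?thesis using reduce_word[OF s inv, of "rev w"] by metis
  qed
  have root_c: "root h \<in> carrier G" if h: "h \<in> carrier G" for h
  proof -
    have "?p [] \<otimes> h \<in> orb h" unfolding orb_def by (rule rangeI)
    then have "root h \<in> orb h" unfolding root_def by (rule someI)
    then show ?thesis using h pc by (auto simp: orb_def)
  qed
  \<comment> \<open>\<open>s i\<close> maps the complement of \<open>W i\<close> into \<open>W i\<close>, so each of the disjoint sets \<open>W i\<close> has measure at least one half\<close>
  define W where "W i = {h \<in> carrier G. \<exists>w. distinct_adj (i # w) \<and> h = ?p (i # w) \<otimes> root h}" for i
  have Wc: "W i \<subseteq> carrier G" for i by (auto simp: W_def)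
  have disj: "W i \<inter> W j = {}" if "i \<noteq> j" for i j
  proof (rule ccontr)
    assume "W i \<inter> W j \<noteq> {}"
    then obtain h v w where h: "h \<in> carrier G" "distinct_adj (i # v)" "h = ?p (i # v) \<otimes> root h"
      "distinct_adj (j # w)" "h = ?p (j # w) \<otimes> root h" unfolding W_def by blast
    then have "?p (i # v) \<otimes> root h = ?p (j # w) \<otimes> root h" by metis
    then have "?p (i # v) = ?p (j # w)" using right_cancel[OF root_c[OF h(1)] pc pc] by blast
    then show False using word_prod_distinct_adj_inj[OF s inv free h(2,4)] that by simp
  qed
  have half: "\<mu> (W i) \<ge> 1 / 2" for i
  proof -
    have "s i <# (carrier G - W i) \<subseteq> W i"
    proof
      fix x assume "x \<in> s i <# (carrier G - W i)"
      then obtain h where h: "h \<in> carrier G" "h \<notin> W i" "x = s i \<otimes> h" by (auto simp: l_coset_def)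
      obtain w where w: "distinct_adj w" "h = ?p w \<otimes> root h" using root[OF h(1)] by blast
      have "w = [] \<or> hd w \<noteq> i"
      proof (rule ccontr)
        assume "\<not> (w = [] \<or> hd w \<noteq> i)"
        then obtain u where "w = i # u" by (cases w) auto
        then show False using w h(1,2) unfolding W_def by blast
      qed
      then have "distinct_adj (i # w)" using w(1) by (auto simp: distinct_adj_Cons)
      moreover have "root x = root h" unfolding root_def h(3) orb_mult[OF h(1)] by simp
      moreover have "x = ?p (i # w) \<otimes> root h"
      proof -
        have "x = s i \<otimes> (?p w \<otimes> root h)" using w(2) h(3) by simp
        then show ?thesis using sc pc root_c[OF h(1)] by (simp add: m_assoc)
      qed
      moreover have "x \<in> carrier G" using h sc by simp
      ultimately show "x \<in> W i" unfolding W_def by auto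
    qed
    then have eq: "(s i <# (carrier G - W i)) \<union> (W i - (s i <# (carrier G - W i))) = W i" by blast
    have c: "s i <# (carrier G - W i) \<subseteq> carrier G" "W i - (s i <# (carrier G - W i)) \<subseteq> carrier G"
      using sc Wc[of i] by (auto simp: l_coset_def)
    have "\<mu> (W i) = \<mu> (s i <# (carrier G - W i)) + \<mu> (W i - (s i <# (carrier G - W i)))"
      using \<mu>(3)[OF c] unfolding eq by blast
    moreover have "\<mu> (s i <# (carrier G - W i)) = \<mu> (carrier G - W i)"
      by (rule \<mu>(4)[OF sc]) blast
    moreover have "\<mu> (carrier G - W i) + \<mu> (W i) = 1"
    proof -
      have "(carrier G - W i) \<union> W i = carrier G" using Wc[of i] by blast
      then show ?thesis using \<mu>(3)[of "carrier G - W i" "W i"] Wc[of i] \<mu>(1) by auto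
    qed
    ultimately show ?thesis using \<mu>(2)[OF c(2)] by linarith
  qed
  have d: "a \<noteq> b" "a \<noteq> c" "b \<noteq> c" using abc by auto
  let ?R = "carrier G - (W a \<union> W b \<union> W c)"
  have "W a \<union> W b \<union> W c \<union> ?R = carrier G" using Wc by blast
  then have "\<mu> (W a \<union> W b \<union> W c \<union> ?R) = 1" using \<mu>(1) by (rule ssubst)
  moreover have "\<mu> (W a \<union> W b \<union> W c \<union> ?R) = \<mu> (W a \<union> W b \<union> W c) + \<mu> ?R"
    by (rule \<mu>(3)) (use Wc in blast)+
  moreover have "\<mu> (W a \<union> W b \<union> W c) = \<mu> (W a \<union> W b) + \<mu> (W c)"
    by (rule \<mu>(3)) (use Wc disj[OF d(2)] disj[OF d(3)] in blast)+
  moreover have "\<mu> (W a \<union> W b) = \<mu> (W a) + \<mu> (W b)"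
    by (rule \<mu>(3)) (use Wc disj[OF d(1)] in blast)+
  moreover have "\<mu> ?R \<ge> 0" by (rule \<mu>(2)) blast
  ultimately show False using half[of a] half[of b] half[of c] \<mu>(1) by linarith
qed

end

section \<open>Permutation groups\<close>

definition perm_group :: "('p \<Rightarrow> 'p) monoid" where
  "perm_group = \<lparr>carrier = {f. bij f}, mult = (\<circ>), one = id\<rparr>"

lemma perm_group_simps [simp]:
  "carrier perm_group = {f. bij f}" "mult perm_group = (\<circ>)" "one perm_group = id"
  by (simp_all add: perm_group_def)

lemma group_perm_group: "group perm_group"
proof (rule groupI)
  fix f :: "'p \<Rightarrow> 'p" assume "f \<in> carrier perm_group"
  then have "bij (inv_into UNIV f)" "inv_into UNIV f \<circ> f = id"
    by (simp_all add: bij_imp_bij_inv bij_is_inj)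
  then show "\<exists>g\<in>carrier perm_group. g \<otimes>\<^bsub>perm_group\<^esub> f = \<one>\<^bsub>perm_group\<^esub>"
    by auto
qed (auto simp: bij_comp o_assoc)

lemma inv_perm_group: "bij f \<Longrightarrow> m_inv perm_group f = inv_into UNIV f"
  by (rule group.inv_equality[OF group_perm_group])
    (simp_all add: bij_imp_bij_inv bij_is_inj)

lemma perm_subgroupI:
  assumes "\<And>f. f \<in> M \<Longrightarrow> bij f" "id \<in> M" "\<And>f g. f \<in> M \<Longrightarrow> g \<in> M \<Longrightarrow> f \<circ> g \<in> M"
    "\<And>f. f \<in> M \<Longrightarrow> inv_into UNIV f \<in> M"
  shows "subgroup M perm_group"
proof (rule group.subgroupI[OF group_perm_group])
  fix f assume "f \<in> M"
  then show "m_inv perm_group f \<in> M" using assms(1,4) by (simp add: inv_perm_group)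
qed (use assms in auto)

lemma perm_subgroupD:
  assumes "subgroup M perm_group"
  shows "f \<in> M \<Longrightarrow> bij f" "id \<in> M" "f \<in> M \<Longrightarrow> g \<in> M \<Longrightarrow> f \<circ> g \<in> M" "f \<in> M \<Longrightarrow> inv_into UNIV f \<in> M"
proof -
  show b: "bij f" if "f \<in> M" for f using subgroup.mem_carrier[OF assms that] by simp
  show "id \<in> M" using subgroup.one_closed[OF assms] by simp
  show "f \<in> M \<Longrightarrow> g \<in> M \<Longrightarrow> f \<circ> g \<in> M" using subgroup.m_closed[OF assms, of f g] by simp
  show "inv_into UNIV f \<in> M" if "f \<in> M"
    using subgroup.m_inv_closed[OF assms that] inv_perm_group[OF b[OF that]] by simp
qed

lemma bij_if_involution: "f \<circ> f = id \<Longrightarrow> bij f"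
  by (metis o_bij)

lemma countable_generate:
  assumes "countable S" shows "countable (generate G S)"
proof -
  define T where "T = rec_nat (S \<union> m_inv G ` S \<union> {\<one>\<^bsub>G\<^esub>})
      (\<lambda>n A. (\<lambda>(x, y). x \<otimes>\<^bsub>G\<^esub> y) ` (A \<times> A) \<union> A)"
  have T0: "T 0 = S \<union> m_inv G ` S \<union> {\<one>\<^bsub>G\<^esub>}" by (simp add: T_def)
  have TS: "T (Suc n) = (\<lambda>(x, y). x \<otimes>\<^bsub>G\<^esub> y) ` (T n \<times> T n) \<union> T n" for n by (simp add: T_def)
  have mono: "m \<le> n \<Longrightarrow> T m \<subseteq> T n" for m n
    by (rule lift_Suc_mono_le) (auto simp: TS)
  have "countable (T n)" for n
    by (induction n) (auto simp: T0 TS assms)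
  moreover have "x \<in> (\<Union>n. T n)" if "x \<in> generate G S" for x
    using that
  proof induction
    case (eng h1 h2)
    then obtain m n where "h1 \<in> T m" "h2 \<in> T n" by blast
    then have "h1 \<in> T (max m n)" "h2 \<in> T (max m n)"
      using mono[of m "max m n"] mono[of n "max m n"] by auto
    then have "h1 \<otimes>\<^bsub>G\<^esub> h2 \<in> T (Suc (max m n))" unfolding TS by force
    then show ?case by blast
  qed (use T0 in blast)+
  ultimately show ?thesis by (meson countable_UN countable_subset subsetI UNIV_I countableI_type)
qed

text \<open>The pointwise stabiliser of \<open>A n\<close> is the kernel of the restriction
  homomorphism into the finite group of permutations of \<open>A n\<close>. As these sets exhaust
  the space, only the identity lies in all the kernels.\<close>

lemma permutation_subgroup_scale:
  fixes H :: "('p \<Rightarrow> 'p) set" and A :: "nat \<Rightarrow> 'p set"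
  assumes H: "subgroup H perm_group" and fin: "\<And>n. finite (A n)" and mono: "\<And>n. A n \<subseteq> A (Suc n)"
    and cover: "(\<Union>n. A n) = UNIV" and pres: "\<And>h n. h \<in> H \<Longrightarrow> h ` A n = A n"
  shows "subgroup_scale (perm_group\<lparr>carrier := H\<rparr>) (\<lambda>n. {h \<in> H. \<forall>a\<in>A n. h a = a})"
proof -
  let ?H = "perm_group\<lparr>carrier := H\<rparr>"
  have grp: "group ?H" using subgroup.subgroup_is_group[OF H group_perm_group] .
  have "finite_index_normal {h \<in> H. \<forall>a\<in>A n. h a = a} ?H" for n
  proof -
    let ?r = "\<lambda>h. restrict h (A n)"
    have Bij: "?r h \<in> Bij (A n)" if "h \<in> H" for h
    proof -
      have "inj_on h (A n)"
        using perm_subgroupD(1)[OF H that] by (meson bij_is_inj inj_on_subset subset_UNIV)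
      then show ?thesis using pres[OF that, of n] by (auto simp: Bij_def bij_betw_def)
    qed
    interpret group_hom ?H "BijGroup (A n)" ?r
    proof (intro group_hom.intro group_hom_axioms.intro grp group_BijGroup homI)
      show "?r h \<in> carrier (BijGroup (A n))" if "h \<in> carrier ?H" for h
        using that Bij by (simp add: BijGroup_def)
      fix g h assume gh: "g \<in> carrier ?H" "h \<in> carrier ?H"
      then have "h ` A n = A n" using pres by simp
      then have "?r (g \<circ> h) = compose (A n) (?r g) (?r h)"
        by (auto simp: compose_def fun_eq_iff)
      then show "?r (g \<otimes>\<^bsub>?H\<^esub> h) = ?r g \<otimes>\<^bsub>BijGroup (A n)\<^esub> ?r h"
        using gh Bij by (simp add: BijGroup_def)
    qed
    have k: "kernel ?H (BijGroup (A n)) ?r = {h \<in> H. \<forall>a\<in>A n. h a = a}"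
      by (auto simp: kernel_def BijGroup_def fun_eq_iff)
    have "Bij (A n) \<subseteq> A n \<rightarrow>\<^sub>E A n"
      by (auto simp: Bij_def PiE_def bij_betw_def)
    then have "finite (carrier (BijGroup (A n)))"
      using finite_PiE[OF fin fin] by (simp add: BijGroup_def finite_subset)
    moreover have "(\<lambda>X. the_elem (?r ` X)) ` carrier (?H Mod kernel ?H (BijGroup (A n)) ?r)
        \<subseteq> carrier (BijGroup (A n))"
      using FactGroup_the_elem_mem by blast
    ultimately have "finite (carrier (?H Mod kernel ?H (BijGroup (A n)) ?r))"
      using FactGroup_inj_on inj_on_finite by blast
    then show ?thesis
      using normal_kernel unfolding finite_index_normal_def k by blast
  qed
  moreover have "h = id" if "\<forall>n. \<forall>a\<in>A n. h a = a" for h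
    using that cover by (metis UNIV_I UN_E eq_id_iff)
  ultimately show ?thesis
    using mono perm_subgroupD(2)[OF H] by (auto simp: subgroup_scale_def subset_iff)
qed

section \<open>The lamplighter-like group\<close>

text \<open>
  A point \<open>(m, x, v, c)\<close> consists of the level \<open>m\<close>, the house \<open>x\<close>, and an element \<open>(v, c)\<close> of the
  set attached to it. The houses are \<open>0 \<le> x < 4 ^ Suc m\<close>, and the set is given by
  \<open>v \<le> length (word m)\<close>; other values of \<open>x\<close> and \<open>v\<close> are never changed.
\<close>
type_synonym point = "nat \<times> int \<times> nat \<times> bool"

text \<open>An enumeration of all reduced words. The default \<open>[]\<close> at codes of other
  lists keeps \<open>word m\<close> reduced on every level, so that every letter acts as an
  involution there.\<close>

definition word :: "nat \<Rightarrow> nat list" where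
  "word m = (let w = from_nat m in if distinct_adj w then w else [])"

text \<open>
  The letter \<open>i\<close> acts on the path \<open>0, \<dots>, length w\<close> by exchanging the endpoints of every edge that
  carries this letter. It is an involution if no two adjacent letters agree, and the product of
  the letters of \<open>w\<close> moves \<open>length w\<close> to \<open>0\<close>.
\<close>
definition step :: "nat \<Rightarrow> nat list \<Rightarrow> nat \<Rightarrow> nat" where
  "step i w v = (if v < length w \<and> w ! v = i then Suc v
     else if 0 < v \<and> v \<le> length w \<and> w ! (v - 1) = i then v - 1 else v)"

text \<open>
  Lamp \<open>0\<close> exchanges two copies of the path, the lamps \<open>1, 2, 3\<close> act on one copy only. Thus the
  commutator of lamp \<open>i\<close> with lamp \<open>0\<close> is the action of the letter \<open>i\<close> on both copies.
\<close>
fun lamp :: "nat \<Rightarrow> nat \<Rightarrow> nat \<times> bool \<Rightarrow> nat \<times> bool" where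
  "lamp i m (v, c) = (if i = 0 then (v, if v \<le> length (word m) then \<not> c else c) else if c then (v, c) else (step i (word m) v, c))"

text \<open>The house of lamp \<open>i\<close> on level \<open>m\<close> after conjugation by
  \<open>shift k\<close>. For \<open>k = 0\<close> the lamps \<open>0\<close> to \<open>3\<close>
  sit at the quarter points of the street.\<close>

definition site :: "nat \<Rightarrow> int \<Rightarrow> nat \<Rightarrow> int" where
  "site i k m = (k + int i * 4 ^ m) mod 4 ^ Suc m"

fun rot :: "int \<Rightarrow> nat \<times> int \<Rightarrow> nat \<times> int" where
  "rot k (m, x) = (m, if x \<in> {0..<4 ^ Suc m} then (x + k) mod 4 ^ Suc m else x)"

fun shift :: "int \<Rightarrow> point \<Rightarrow> point" where
  "shift k (m, x, p) = (m, if x \<in> {0..<4 ^ Suc m} then (x + k) mod 4 ^ Suc m else x, p)"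

fun light :: "nat \<Rightarrow> int \<Rightarrow> point \<Rightarrow> point" where
  "light i k (m, x, p) = (m, x, if x = site i k m then lamp i m p else p)"

text \<open>For \<open>i\<close> from \<open>1\<close> to \<open>3\<close> these are the free
  involutions that enlarge the lamp group. Each acts on all levels at once and is a limit of
  products of commutators in the lamp group.\<close>

fun twist :: "nat \<Rightarrow> point \<Rightarrow> point" where
  "twist i (m, x, v, c) = (m, x, if x = 0 then step i (word m) v else v, c)"

fun base :: "point \<Rightarrow> nat \<times> int" where
  "base (m, x, p) = (m, x)"

section \<open>Elementary properties of letters, sites, rotations and lights\<close>

lemma distinct_adj_word: "distinct_adj (word m)"
  by (simp add: word_def Let_def)

lemma word_surj: "distinct_adj w \<Longrightarrow> \<exists>m. word m = w"
  by (rule exI[of _ "to_nat w"]) (simp add: word_def)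

lemma step_le: "v \<le> length w \<Longrightarrow> step i w v \<le> length w"
  by (auto simp: step_def)

lemma step_gt: "length w < v \<Longrightarrow> step i w v = v"
  by (auto simp: step_def)

lemma step_step:
  assumes "distinct_adj w" shows "step i w (step i w v) = v"
proof -
  have d: "Suc j < length w \<Longrightarrow> w ! j \<noteq> w ! Suc j" for j
    using distinct_adj_nth[OF assms] by blast
  show ?thesis
    using d[of v] d[of "v - 1"] d[of "v - 2"] by (cases v) (auto simp: step_def Suc_le_eq split: if_splits)
qed

lemma lamp_lamp: "lamp i m (lamp i m p) = p"
  by (cases p) (auto simp: step_step distinct_adj_word)

lemma site_range: "site i k m \<in> {0..<4 ^ Suc m}"
  by (simp add: site_def)

lemma site_shift: "(site i k m + l) mod 4 ^ Suc m = site i (k + l) m"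
  by (simp add: site_def mod_simps algebra_simps)

lemma small_lt_pow4: "2 * int m < 4 ^ m"
proof (induction m)
  case (Suc m)
  then show ?case by (cases m) auto
qed simp

lemma lt_pow4_Suc: "int m < 4 ^ Suc m"
  using small_lt_pow4[of m] by simp

text \<open>This is the moving apart of the houses. Equal sites make \<open>k - k'\<close> a
  multiple of \<open>4 ^ m\<close>, but its absolute value is at most \<open>2 * m\<close>, which is
  smaller; so \<open>k = k'\<close>, and then \<open>i\<close> and \<open>i'\<close> agree modulo
  \<open>4\<close>.\<close>

lemma site_inj:
  assumes "site i k m = site i' k' m" "i \<le> 3" "i' \<le> 3" "\<bar>k\<bar> \<le> int m" "\<bar>k'\<bar> \<le> int m"
  shows "i = i' \<and> k = k'"
proof -
  have "(4 ^ Suc m :: int) dvd (k + int i * 4 ^ m) - (k' + int i' * 4 ^ m)"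
    using assms(1) by (simp only: site_def mod_eq_dvd_iff)
  then obtain d where d: "(k + int i * 4 ^ m) - (k' + int i' * 4 ^ m) = 4 ^ Suc m * d" by (elim dvdE)
  then have kk: "k - k' = 4 ^ m * (4 * d - int i + int i')" by (simp add: algebra_simps)
  have "k = k'"
  proof (rule ccontr)
    assume "k \<noteq> k'"
    then have "(4 ^ m :: int) \<le> \<bar>k - k'\<bar>"
      using kk by (intro zdvd_imp_le) auto
    then show False using assms(4,5) small_lt_pow4[of m] by linarith
  qed
  then have "4 * d - int i + int i' = 0" using kk by simp
  then show ?thesis using assms(2,3) \<open>k = k'\<close> by presburger
qed

lemma shift_shift: "shift k (shift l a) = shift (k + l) a"
  by (cases a) (auto simp: mod_simps algebra_simps)

lemma shift_0: "shift 0 = id"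
  by (auto simp: fun_eq_iff)

lemma shift_comp: "shift k \<circ> shift l = shift (k + l)"
  by (auto simp: fun_eq_iff shift_shift simp del: shift.simps)

lemma rot_comp: "rot k \<circ> rot l = rot (k + l)"
  by (auto simp: fun_eq_iff mod_simps algebra_simps)

lemma rot_0: "rot 0 = id"
  by (auto simp: fun_eq_iff)

lemma bij_shift: "bij (shift k)"
  by (rule o_bij[of "shift (- k)"]) (simp_all add: shift_comp shift_0)

lemma inv_shift: "inv_into UNIV (shift k) = shift (- k)"
  by (rule inv_unique_comp) (simp_all add: shift_comp shift_0)

lemma base_shift: "base \<circ> shift k = rot k \<circ> base"
  by (auto simp: fun_eq_iff)

lemma light_light: "light i k \<circ> light i k = id"
  by (auto simp: fun_eq_iff lamp_lamp simp del: lamp.simps)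

lemma light_conj: "shift l \<circ> light i k \<circ> shift (- l) = light i (k + l)"
proof (rule ext)
  fix a :: point
  obtain m x p where a: "a = (m, x, p)" by (cases a)
  show "(shift l \<circ> light i k \<circ> shift (- l)) a = light i (k + l) a"
  proof (cases "x \<in> {0..<4 ^ Suc m}")
    case True
    have "(x - l) mod 4 ^ Suc m = site i k m \<longleftrightarrow> x = site i (k + l) m"
    proof
      assume "(x - l) mod 4 ^ Suc m = site i k m"
      then have "((x - l) mod 4 ^ Suc m + l) mod 4 ^ Suc m = site i (k + l) m" by (simp only: site_shift)
      then show "x = site i (k + l) m" using True by (simp add: mod_simps)
    next
      assume "x = site i (k + l) m"
      then have "(x + - l) mod 4 ^ Suc m = site i (k + l + - l) m" by (simp only: site_shift)
      then show "(x - l) mod 4 ^ Suc m = site i k m" by simp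
    qed
    moreover have "((x - l) mod 4 ^ Suc m + l) mod 4 ^ Suc m = x" using True by (simp add: mod_simps)
    moreover have "(x - l) mod 4 ^ Suc m \<in> {0..<4 ^ Suc m}" by simp
    ultimately show ?thesis using True unfolding a by (simp del: lamp.simps power_Suc)
  next
    case False
    then have "x \<noteq> site i k m" "x \<noteq> site i (k + l) m" using site_range by metis+
    then show ?thesis using False unfolding a by (auto simp del: lamp.simps power_Suc)
  qed
qed

lemma twist_twist: "twist i \<circ> twist i = id"
  by (auto simp: fun_eq_iff step_step distinct_adj_word)

section \<open>The two groups and their generators\<close>

definition gens :: "(point \<Rightarrow> point) set" where
  "gens = insert (shift 1) ((\<lambda>i. light i 0) ` {..3})"

definition twists :: "(point \<Rightarrow> point) set" where
  "twists = twist ` {1..3}"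

definition lamp_group :: "(point \<Rightarrow> point) set" where
  "lamp_group = generate perm_group gens"

definition big_group :: "(point \<Rightarrow> point) set" where
  "big_group = generate perm_group (gens \<union> twists)"

lemma bij_gens: "gens \<union> twists \<subseteq> carrier perm_group"
  by (auto simp: gens_def twists_def bij_shift bij_if_involution light_light twist_twist)

lemma subgroup_lamp_group: "subgroup lamp_group perm_group"
  unfolding lamp_group_def using bij_gens by (intro group.generate_is_subgroup[OF group_perm_group]) simp

lemma subgroup_big_group: "subgroup big_group perm_group"
  unfolding big_group_def using bij_gens by (intro group.generate_is_subgroup[OF group_perm_group]) simp

lemma lamp_group_subset: "lamp_group \<subseteq> big_group"
  unfolding lamp_group_def big_group_def by (rule group.mono_generate[OF group_perm_group]) simp

lemmas lamp_groupD = perm_subgroupD[OF subgroup_lamp_group]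
lemmas big_groupD = perm_subgroupD[OF subgroup_big_group]

lemma light_0_lamp_group: "i \<le> 3 \<Longrightarrow> light i 0 \<in> lamp_group"
  unfolding lamp_group_def by (rule generate.incl) (simp add: gens_def)

lemma shift_lamp_group: "shift k \<in> lamp_group"
proof -
  have nat: "shift (int n) \<in> lamp_group" for n
  proof (induction n)
    case 0
    show ?case using lamp_groupD(2) by (simp only: of_nat_0 shift_0)
  next
    case (Suc n)
    have "shift 1 \<in> lamp_group"
      unfolding lamp_group_def by (rule generate.incl) (simp add: gens_def)
    from lamp_groupD(3)[OF this Suc] show ?case by (simp add: shift_comp)
  qed
  show ?thesis
  proof (cases "k \<ge> 0")
    case True
    then show ?thesis using nat[of "nat k"] by simp
  next
    case False
    then show ?thesis using lamp_groupD(4)[OF nat[of "nat (- k)"]] by (simp add: inv_shift)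
  qed
qed

lemma light_lamp_group: "i \<le> 3 \<Longrightarrow> light i k \<in> lamp_group"
  using lamp_groupD(3)[OF lamp_groupD(3)[OF shift_lamp_group[of k] light_0_lamp_group] shift_lamp_group[of "- k"]]
  unfolding light_conj by simp

section \<open>Finite invariant windows\<close>

text \<open>Finite sets that exhaust all points, also those off the streets and beyond the paths.
  They are invariant under both groups, since on each level \<open>m \<le> n\<close> they contain
  the full street and the full path; their pointwise stabilisers form the scale.\<close>

definition window :: "nat \<Rightarrow> point set" where
  "window n = (SIGMA m:{..n}. {- (4 ^ Suc n)..4 ^ Suc n} \<times> {..n + length (word m)} \<times> UNIV)"

lemma finite_window: "finite (window n)"
  unfolding window_def by (intro finite_SigmaI finite_cartesian_product) auto

lemma window_mono: "window n \<subseteq> window (Suc n)"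
proof -
  have "(4::int) ^ Suc n \<le> 4 ^ Suc (Suc n)" by simp
  then have "{- (4 ^ Suc n :: int)..4 ^ Suc n} \<subseteq> {- (4 ^ Suc (Suc n))..4 ^ Suc (Suc n)}"
    unfolding atLeastatMost_subset_iff by linarith
  then show ?thesis unfolding window_def by fastforce
qed

lemma window_cover: "(\<Union>n. window n) = UNIV"
proof -
  have "a \<in> (\<Union>n. window n)" for a
  proof -
    obtain m x v c where a: "a = (m, x, v, c)" by (cases a)
    let ?n = "m + nat \<bar>x\<bar> + v"
    have "int ?n < 4 ^ Suc ?n"
      by (rule lt_pow4_Suc)
    then have "- (4 ^ Suc ?n) \<le> x" "x \<le> 4 ^ Suc ?n" by linarith+
    then have "a \<in> window ?n" by (simp add: window_def a del: power_Suc)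
    then show ?thesis by blast
  qed
  then show ?thesis by blast
qed

lemma pow4_mono: "m \<le> n \<Longrightarrow> (4::int) ^ Suc m \<le> 4 ^ Suc n"
  by (intro power_increasing) auto

lemma lamp_le: "fst p \<le> n + length (word m) \<Longrightarrow> fst (lamp i m p) \<le> n + length (word m)"
  by (cases p; cases "fst p \<le> length (word m)")
    (auto simp: step_gt intro: order_trans[OF step_le])

lemma gens_window: "f \<in> gens \<union> twists \<Longrightarrow> f ` window n \<subseteq> window n"
proof (rule image_subsetI)
  fix a assume f: "f \<in> gens \<union> twists" and a: "a \<in> window n"
  obtain m x v c where a': "a = (m, x, v, c)" by (cases a)
  have b: "m \<le> n" "- (4 ^ Suc n) \<le> x" "x \<le> 4 ^ Suc n" "v \<le> n + length (word m)"
    using a by (simp_all add: a' window_def)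
  consider "f = shift 1" | i where "f = light i 0" | i where "f = twist i"
    using f by (auto simp: gens_def twists_def)
  then show "f a \<in> window n"
  proof cases
    case 1
    have "0 \<le> (x + 1) mod 4 ^ Suc m" "(x + 1) mod 4 ^ Suc m < 4 ^ Suc m" by simp_all
    moreover have "(0::int) \<le> 4 ^ Suc n" by simp
    ultimately have "- (4 ^ Suc n) \<le> (x + 1) mod 4 ^ Suc m" "(x + 1) mod 4 ^ Suc m \<le> 4 ^ Suc n"
      using pow4_mono[OF b(1)] by linarith+
    then show ?thesis
      using b unfolding 1 a' window_def by (simp del: power_Suc)
  next
    case (2 i)
    have "fst (lamp i m (v, c)) \<le> n + length (word m)"
      using b(4) by (intro lamp_le) simp
    then show ?thesis
      using b unfolding 2 a' window_def
      by (cases "lamp i m (v, c)") (simp del: power_Suc lamp.simps)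
  next
    case (3 i)
    have "step i (word m) v \<le> n + length (word m)"
      using lamp_le[of "(v, False)" n m "Suc 0"] b(4) step_le[of v "word m" i] step_gt[of "word m" v i]
      by (cases "v \<le> length (word m)") auto
    then show ?thesis
      using b unfolding 3 a' window_def by (simp del: power_Suc)
  qed
qed

lemma big_group_window: "h \<in> big_group \<Longrightarrow> h ` window n = window n"
proof -
  let ?M = "{f. bij f \<and> f ` window n = window n}"
  have "subgroup ?M perm_group"
  proof (rule perm_subgroupI)
    fix f g assume "f \<in> ?M" "g \<in> ?M"
    then have "(f \<circ> g) ` window n = window n" by (simp only: image_comp[symmetric] mem_Collect_eq)
    with \<open>f \<in> ?M\<close> \<open>g \<in> ?M\<close> show "f \<circ> g \<in> ?M" by (simp add: bij_comp)
  next
    fix f assume f: "f \<in> ?M"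
    then have "inv_into UNIV f ` (f ` window n) = window n"
      by (intro image_inv_f_f bij_is_inj) simp
    then show "inv_into UNIV f \<in> ?M" using f by (simp add: bij_imp_bij_inv)
  qed auto
  moreover have "gens \<union> twists \<subseteq> ?M"
  proof
    fix f assume f: "f \<in> gens \<union> twists"
    then have "bij f" using bij_gens by auto
    moreover from this have "inj_on f (window n)" by (meson bij_is_inj inj_on_subset subset_UNIV)
    then have "f ` window n = window n"
      using endo_inj_surj[OF finite_window gens_window[OF f]] by blast
    ultimately show "f \<in> ?M" by simp
  qed
  ultimately have "big_group \<subseteq> ?M"
    unfolding big_group_def by (intro group.generate_subgroup_incl[OF group_perm_group])
  then show "h \<in> big_group \<Longrightarrow> h ` window n = window n" by blast
qed

section \<open>Density of the lamp group in the big group\<close>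

text \<open>Rotation by \<open>- (int i * 4 ^ j)\<close> brings lamp \<open>i\<close> to house
  \<open>0\<close> on level \<open>j\<close> only: on lower levels it is a multiple of the length of
  the street, on higher levels it is too short to reach house \<open>0\<close>.\<close>

lemma site_ne_0:
  assumes "1 \<le> i" "i \<le> 3" "m \<noteq> j"
  shows "site i (- (int i * 4 ^ j)) m \<noteq> 0"
proof (cases "m < j")
  case True
  then have "(4 ^ Suc m :: int) dvd int i * 4 ^ j" by (intro dvd_mult le_imp_power_dvd) simp
  then have "(4 ^ Suc m :: int) dvd - (int i * 4 ^ j)" by simp
  then have "site i (- (int i * 4 ^ j)) m = (int i * 4 ^ m) mod 4 ^ Suc m"
    unfolding site_def by (metis add.commute mod_add_right_eq dvd_imp_mod_0 add.right_neutral)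
  also have "\<dots> = int i * 4 ^ m" using assms(2) by (intro mod_pos_pos_trivial) auto
  finally show ?thesis using assms(1) by simp
next
  case False
  then have "j < m" using assms(3) by simp
  then have "(4 ^ j :: int) < 4 ^ m" by (intro power_strict_increasing) auto
  then have "0 < int i * (4 ^ m - 4 ^ j)" using assms(1) by simp
  moreover have "int i * (4 ^ m - 4 ^ j) < 4 ^ Suc m"
  proof -
    have "int i * (4 ^ m - 4 ^ j) \<le> 3 * (4 ^ m - 4 ^ j)"
      using assms(2) \<open>4 ^ j < 4 ^ m\<close> by (intro mult_right_mono) auto
    also have "\<dots> < 4 ^ Suc m"
    proof -
      have "(0::int) < 4 ^ j" "(0::int) < 4 ^ m" by simp_all
      then show ?thesis unfolding power_Suc right_diff_distrib by linarith
    qed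
    finally show ?thesis .
  qed
  moreover have "- (int i * 4 ^ j) + int i * 4 ^ m = int i * (4 ^ m - 4 ^ j)"
    by (simp add: algebra_simps)
  ultimately have "site i (- (int i * 4 ^ j)) m = int i * (4 ^ m - 4 ^ j)"
    unfolding site_def by (simp only: mod_pos_pos_trivial less_imp_le)
  then show ?thesis using \<open>0 < int i * (4 ^ m - 4 ^ j)\<close> by linarith
qed

text \<open>Both factors are involutions, so this is their commutator. On levels other than
  \<open>j\<close> they act at different houses and commute. On level \<open>j\<close>,
  \<open>g\<close> moves one copy of the path and its conjugate by the exchange of copies moves the
  other.\<close>

lemma commutator_light:
  fixes i j :: nat
  assumes i: "1 \<le> i" "i \<le> 3"
  defines "g \<equiv> light i (- (int i * 4 ^ j))"
  shows "(g \<circ> light 0 0 \<circ> g \<circ> light 0 0) (m, x, v, c)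
    = (m, x, if m = j \<and> x = 0 then step i (word m) v else v, c)"
proof -
  have z: "site 0 0 m = 0" by (simp add: site_def)
  show ?thesis
  proof (cases "m = j")
    case True
    have s: "site i (- (int i * 4 ^ j)) j = 0" by (simp add: site_def)
    show ?thesis
      using i z step_le[of v "word j" i] step_gt[of "word j" v i]
      unfolding True g_def by (cases "v \<le> length (word j)") (simp_all add: s)
  next
    case False
    show ?thesis
      using site_ne_0[OF i False] z lamp_lamp[of i m "(v, c)"] lamp_lamp[of 0 m "(v, c)"] False
      unfolding g_def by (cases "x = 0"; cases "x = site i (- (int i * 4 ^ j)) m")
        (simp_all del: lamp.simps)
  qed
qed

text \<open>The product of the commutators for the levels below \<open>n\<close> agrees with
  \<open>twist i\<close> on all those levels.\<close>

lemma twist_approx: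
  assumes i: "1 \<le> i" "i \<le> 3"
  shows "\<exists>g\<in>lamp_group. \<forall>m x v c. g (m, x, v, c) = (m, x, if m < n \<and> x = 0 then step i (word m) v else v, c)"
proof (induction n)
  case 0
  show ?case using lamp_groupD(2) by (intro bexI[of _ id]) auto
next
  case (Suc n)
  then obtain g where g: "g \<in> lamp_group"
    "\<And>m x v c. g (m, x, v, c) = (m, x, if m < n \<and> x = 0 then step i (word m) v else v, c)"
    by blast
  define h where "h = light i (- (int i * 4 ^ n)) \<circ> light 0 0 \<circ> light i (- (int i * 4 ^ n)) \<circ> light 0 0"
  have h: "h (m, x, v, c) = (m, x, if m = n \<and> x = 0 then step i (word m) v else v, c)" for m x v c
    unfolding h_def by (rule commutator_light[OF i])
  have "h \<in> lamp_group"
    unfolding h_def using i by (intro lamp_groupD(3) light_lamp_group) auto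
  then have "h \<circ> g \<in> lamp_group" using g(1) by (intro lamp_groupD(3))
  moreover have "(h \<circ> g) (m, x, v, c) = (m, x, if m < Suc n \<and> x = 0 then step i (word m) v else v, c)"
    for m x v c by (auto simp: g(2) h less_Suc_eq)
  ultimately show ?case by blast
qed

lemma lamp_group_dense:
  assumes "h \<in> big_group"
  shows "\<exists>g\<in>lamp_group. \<forall>a\<in>window n. h a = g a"
proof -
  \<comment> \<open>Invariance of the windows is built into \<open>?M\<close>: a composite or an
    inverse is approximated on a window only if the permutation applied first keeps that
    window.\<close>
  let ?M = "{h. bij h \<and> (\<forall>n. h ` window n = window n) \<and> (\<forall>n. \<exists>g\<in>lamp_group. \<forall>a\<in>window n. h a = g a)}"
  have "subgroup ?M perm_group"
  proof (rule perm_subgroupI)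
    have "\<exists>g\<in>lamp_group. \<forall>a\<in>window n. id a = g a" for n using lamp_groupD(2) by blast
    then show "id \<in> ?M" by simp
    fix f assume f: "f \<in> ?M"
    then show bf: "bij f" by simp
    have inv: "inv_into UNIV f ` window n = window n" for n
    proof -
      have "inv_into UNIV f ` (f ` window n) = window n"
        by (intro image_inv_f_f bij_is_inj bf)
      then show ?thesis using f by simp
    qed
    have "\<exists>g\<in>lamp_group. \<forall>a\<in>window n. inv_into UNIV f a = g a" for n
    proof -
      have "\<exists>g\<in>lamp_group. \<forall>a\<in>window n. f a = g a" using f by (elim CollectE conjE) (rule spec)
      then obtain g where g: "g \<in> lamp_group" "\<And>a. a \<in> window n \<Longrightarrow> f a = g a" by blast
      have "inv_into UNIV f a = inv_into UNIV g a" if "a \<in> window n" for a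
      proof -
        have "inv_into UNIV f a \<in> window n" using inv[of n] that by blast
        from g(2)[OF this] have "g (inv_into UNIV f a) = f (inv_into UNIV f a)" by (rule sym)
        also have "\<dots> = a" by (rule surj_f_inv_f[OF bij_is_surj[OF bf]])
        finally show ?thesis by (rule inv_f_eq[OF bij_is_inj[OF lamp_groupD(1)[OF g(1)]], symmetric])
      qed
      then show ?thesis using lamp_groupD(4)[OF g(1)] by blast
    qed
    then show "inv_into UNIV f \<in> ?M" using inv bf by (simp add: bij_imp_bij_inv)
  next
    fix f f' assume f: "f \<in> ?M" "f' \<in> ?M"
    have "(f \<circ> f') ` window n = window n" for n
      using f by (simp only: image_comp[symmetric] mem_Collect_eq)
    moreover have "\<exists>g\<in>lamp_group. \<forall>a\<in>window n. (f \<circ> f') a = g a" for n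
    proof -
      have "\<exists>g\<in>lamp_group. \<forall>a\<in>window n. f a = g a"
        using f(1) by (elim CollectE conjE) (rule spec)
      moreover have "\<exists>g\<in>lamp_group. \<forall>a\<in>window n. f' a = g a"
        using f(2) by (elim CollectE conjE) (rule spec)
      ultimately obtain g g' where g: "g \<in> lamp_group" "g' \<in> lamp_group"
        "\<And>a. a \<in> window n \<Longrightarrow> f a = g a" "\<And>a. a \<in> window n \<Longrightarrow> f' a = g' a" by blast
      have "f' a \<in> window n" if "a \<in> window n" for a using f(2) that by blast
      then have "(f \<circ> f') a = (g \<circ> g') a" if "a \<in> window n" for a using g(3,4) that by simp
      then show ?thesis using lamp_groupD(3)[OF g(1,2)] by blast
    qed
    ultimately show "f \<circ> f' \<in> ?M" using f by (simp add: bij_comp)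
  qed
  moreover have "gens \<union> twists \<subseteq> ?M"
  proof
    fix f assume f: "f \<in> gens \<union> twists"
    have "f \<in> big_group" unfolding big_group_def using f by (rule generate.incl)
    moreover have "\<exists>g\<in>lamp_group. \<forall>a\<in>window n. f a = g a" for n
    proof (cases "f \<in> gens")
      case True
      then have "f \<in> lamp_group" unfolding lamp_group_def by (rule generate.incl)
      then show ?thesis by blast
    next
      case False
      then obtain i where i: "1 \<le> i" "i \<le> 3" "f = twist i" using f by (auto simp: twists_def)
      \<comment> \<open>\<open>window n\<close> includes level \<open>n\<close> itself, hence
        \<open>Suc n\<close>.\<close>
      obtain g where g: "g \<in> lamp_group"
        "\<And>m x v c. g (m, x, v, c) = (m, x, if m < Suc n \<and> x = 0 then step i (word m) v else v, c)"
        using twist_approx[OF i(1,2), of "Suc n"] by blast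
      have "f a = g a" if a: "a \<in> window n" for a
      proof -
        obtain m x v c where a': "a = (m, x, v, c)" by (cases a)
        have "m < Suc n" using a by (simp add: a' window_def)
        then show ?thesis unfolding a' i(3) g(2) by simp
      qed
      then show ?thesis using g(1) by blast
    qed
    ultimately show "f \<in> ?M" using big_groupD(1) big_group_window by blast
  qed
  ultimately have "big_group \<subseteq> ?M"
    unfolding big_group_def by (intro group.generate_subgroup_incl[OF group_perm_group])
  then show ?thesis using assms by blast
qed

section \<open>Finite groups of settled permutations\<close>

text \<open>
  From level \<open>M\<close> on, \<open>f\<close> is the product of the commuting involutions \<open>light i k\<close> with
  \<open>(i, k) \<in> \<epsilon>\<close>.
\<close>
definition lit :: "(nat \<times> int) set \<Rightarrow> nat \<Rightarrow> (point \<Rightarrow> point) \<Rightarrow> bool" where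
  "lit \<epsilon> M f \<longleftrightarrow> (\<forall>m\<ge>M. \<forall>x p.
      (\<forall>i k. (i, k) \<in> \<epsilon> \<longrightarrow> x = site i k m \<longrightarrow> f (m, x, p) = (m, x, lamp i m p))
    \<and> ((\<forall>i k. (i, k) \<in> \<epsilon> \<longrightarrow> x \<noteq> site i k m) \<longrightarrow> f (m, x, p) = (m, x, p)))"

text \<open>These sets are finite groups whose members in the lamp group make up the elements that
  move no house. Bounding \<open>k\<close> by \<open>M\<close> is what lets \<open>site_inj\<close>
  separate the sites on all levels from \<open>M\<close> on; below level \<open>M\<close> the action
  on the attached sets is arbitrary.\<close>

definition settled :: "nat \<Rightarrow> (point \<Rightarrow> point) set" where
  "settled M = {f. bij f \<and> base \<circ> f = base
     \<and> (\<forall>m x v c. x \<notin> {0..<4 ^ Suc m} \<or> length (word m) < v \<longrightarrow> f (m, x, v, c) = (m, x, v, c))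
     \<and> (\<exists>\<epsilon> \<subseteq> {..3} \<times> {- int M..int M}. lit \<epsilon> M f)}"

lemma litI:
  assumes "\<And>m x p i k. M \<le> m \<Longrightarrow> (i, k) \<in> \<epsilon> \<Longrightarrow> x = site i k m \<Longrightarrow> f (m, x, p) = (m, x, lamp i m p)"
    and "\<And>m x p. M \<le> m \<Longrightarrow> (\<And>i k. (i, k) \<in> \<epsilon> \<Longrightarrow> x \<noteq> site i k m) \<Longrightarrow> f (m, x, p) = (m, x, p)"
  shows "lit \<epsilon> M f"
  unfolding lit_def using assms by blast

lemma litD:
  assumes "lit \<epsilon> M f" "M \<le> m"
  shows "(i, k) \<in> \<epsilon> \<Longrightarrow> f (m, site i k m, p) = (m, site i k m, lamp i m p)"
    and "(\<And>i k. (i, k) \<in> \<epsilon> \<Longrightarrow> x \<noteq> site i k m) \<Longrightarrow> f (m, x, p) = (m, x, p)"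
  using assms unfolding lit_def by blast+

lemma settledI:
  assumes "bij f" "base \<circ> f = base"
    and "\<And>m x v c. x \<notin> {0..<4 ^ Suc m} \<Longrightarrow> f (m, x, v, c) = (m, x, v, c)"
    and "\<And>m x v c. length (word m) < v \<Longrightarrow> f (m, x, v, c) = (m, x, v, c)"
    and "\<epsilon> \<subseteq> {..3} \<times> {- int M..int M}" "lit \<epsilon> M f"
  shows "f \<in> settled M"
  unfolding settled_def using assms by blast

lemma settledD:
  assumes "f \<in> settled M"
  shows "bij f" "base \<circ> f = base"
    "x \<notin> {0..<4 ^ Suc m} \<Longrightarrow> f (m, x, v, c) = (m, x, v, c)"
    "length (word m) < v \<Longrightarrow> f (m, x, v, c) = (m, x, v, c)"
    "\<exists>\<epsilon> \<subseteq> {..3} \<times> {- int M..int M}. lit \<epsilon> M f"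
  using assms unfolding settled_def by blast+

lemma lit_mono:
  assumes l: "lit \<epsilon> M f" and le: "M \<le> M'" shows "lit \<epsilon> M' f"
proof (rule litI)
  fix m x p i k assume m: "M' \<le> m" and ik: "(i, k) \<in> \<epsilon>" and x: "x = site i k m"
  show "f (m, x, p) = (m, x, lamp i m p)"
    unfolding x by (rule litD(1)[OF l order_trans[OF le m] ik])
next
  fix m x p assume m: "M' \<le> m" and x: "\<And>i k. (i, k) \<in> \<epsilon> \<Longrightarrow> x \<noteq> site i k m"
  show "f (m, x, p) = (m, x, p)"
    by (rule litD(2)[OF l order_trans[OF le m] x])
qed

lemma settled_mono:
  assumes "M \<le> M'" shows "settled M \<subseteq> settled M'"
proof
  fix f assume f: "f \<in> settled M"
  obtain \<epsilon> where e: "\<epsilon> \<subseteq> {..3} \<times> {- int M..int M}" "lit \<epsilon> M f"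
    using settledD(5)[OF f] by blast
  have "{- int M..int M} \<subseteq> {- int M'..int M'}" using assms by auto
  then have "\<epsilon> \<subseteq> {..3} \<times> {- int M'..int M'}" using e(1) by blast
  note e' = this
  show "f \<in> settled M'"
    by (rule settledI)
      (rule settledD(1,2)[OF f] e' lit_mono[OF e(2) assms] | erule settledD(3,4)[OF f])+
qed

lemma light_settled:
  assumes "i \<le> 3" shows "light i k \<in> settled (nat \<bar>k\<bar>)"
proof (rule settledI)
  show "bij (light i k)" by (rule bij_if_involution[OF light_light])
  show "base \<circ> light i k = base" by (auto simp: fun_eq_iff)
  show "light i k (m, x, v, c) = (m, x, v, c)" if "x \<notin> {0..<4 ^ Suc m}" for m x v c
  proof -
    have "x \<noteq> site i k m" using that site_range[of i k m] by blast
    then show ?thesis by simp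
  qed
  show "light i k (m, x, v, c) = (m, x, v, c)" if "length (word m) < v" for m x v c
    using that by (simp add: step_gt)
  show "{(i, k)} \<subseteq> {..3} \<times> {- int (nat \<bar>k\<bar>)..int (nat \<bar>k\<bar>)}" using assms by auto
  show "lit {(i, k)} (nat \<bar>k\<bar>) (light i k)" by (rule litI) (simp_all del: lamp.simps)
qed

lemma id_settled: "id \<in> settled M"
  by (rule settledI[of _ "{}"]) (simp_all add: lit_def)

text \<open>From level \<open>M\<close> on, different pairs \<open>(i, k)\<close> have different
  sites. A light occurring in both factors cancels, and the others act at separate houses, so the
  composite belongs to the symmetric difference.\<close>

lemma settled_comp:
  assumes "f \<in> settled M" "g \<in> settled M" shows "f \<circ> g \<in> settled M"
proof -
  obtain \<epsilon> where \<epsilon>: "\<epsilon> \<subseteq> {..3} \<times> {- int M..int M}" "lit \<epsilon> M f"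
    using settledD(5)[OF assms(1)] by blast
  note f = settledD(1-4)[OF assms(1)] \<epsilon>
  obtain \<delta> where \<delta>: "\<delta> \<subseteq> {..3} \<times> {- int M..int M}" "lit \<delta> M g"
    using settledD(5)[OF assms(2)] by blast
  note g = settledD(1-4)[OF assms(2)] \<delta>
  have inj: "i = i' \<and> k = k'" if "M \<le> m" "(i, k) \<in> \<epsilon> \<union> \<delta>" "(i', k') \<in> \<epsilon> \<union> \<delta>" "site i k m = site i' k' m"
    for m i k i' k'
  proof (rule site_inj[OF that(4)])
    have b: "(i, k) \<in> {..3} \<times> {- int M..int M}" "(i', k') \<in> {..3} \<times> {- int M..int M}"
      using that(2,3) f(5) g(5) by blast+
    show "i \<le> 3" "i' \<le> 3" "\<bar>k\<bar> \<le> int m" "\<bar>k'\<bar> \<le> int m" using b that(1) by auto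
  qed
  show ?thesis
  proof (rule settledI)
    show "bij (f \<circ> g)" using f(1) g(1) by (simp add: bij_comp)
    show "base \<circ> (f \<circ> g) = base" using f(2) g(2) by (simp add: o_assoc)
    show "(f \<circ> g) (m, x, v, c) = (m, x, v, c)" if "x \<notin> {0..<4 ^ Suc m}" for m x v c
      using f(3)[OF that] g(3)[OF that] by simp
    show "(f \<circ> g) (m, x, v, c) = (m, x, v, c)" if "length (word m) < v" for m x v c
      using f(4)[OF that] g(4)[OF that] by simp
    show "(\<epsilon> - \<delta>) \<union> (\<delta> - \<epsilon>) \<subseteq> {..3} \<times> {- int M..int M}" using f(5) g(5) by blast
    show "lit ((\<epsilon> - \<delta>) \<union> (\<delta> - \<epsilon>)) M (f \<circ> g)"
    proof (rule litI)
      fix m x p i k assume m: "M \<le> m" and ik: "(i, k) \<in> (\<epsilon> - \<delta>) \<union> (\<delta> - \<epsilon>)" and x: "x = site i k m"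
      show "(f \<circ> g) (m, x, p) = (m, x, lamp i m p)"
      proof (cases "(i, k) \<in> \<epsilon>")
        case True
        have "g (m, x, q) = (m, x, q)" for q
        proof (rule litD(2)[OF g(6) m])
          fix i' k' assume "(i', k') \<in> \<delta>"
          then show "x \<noteq> site i' k' m" using inj[OF m, of i k i' k'] ik True unfolding x by blast
        qed
        then show ?thesis using litD(1)[OF f(6) m True] unfolding x by simp
      next
        case False
        have "f (m, x, q) = (m, x, q)" for q
        proof (rule litD(2)[OF f(6) m])
          fix i' k' assume "(i', k') \<in> \<epsilon>"
          then show "x \<noteq> site i' k' m" using inj[OF m, of i k i' k'] ik False unfolding x by blast
        qed
        moreover have "(i, k) \<in> \<delta>" using ik False by blast
        ultimately show ?thesis using litD(1)[OF g(6) m, of i k] unfolding x by simp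
      qed
    next
      fix m x p assume m: "M \<le> m"
        and x: "\<And>i k. (i, k) \<in> (\<epsilon> - \<delta>) \<union> (\<delta> - \<epsilon>) \<Longrightarrow> x \<noteq> site i k m"
      show "(f \<circ> g) (m, x, p) = (m, x, p)"
      proof (cases "\<exists>i k. (i, k) \<in> \<epsilon> \<and> x = site i k m")
        case True
        then obtain i k where ik: "(i, k) \<in> \<epsilon>" "x = site i k m" by blast
        then have "(i, k) \<in> \<delta>" using x[of i k] by blast
        then show ?thesis
          using litD(1)[OF f(6) m ik(1)] litD(1)[OF g(6) m, of i k] unfolding ik(2)
          by (simp add: lamp_lamp del: lamp.simps)
      next
        case False
        have "f (m, x, q) = (m, x, q)" for q
          by (rule litD(2)[OF f(6) m]) (use False in blast)
        moreover have "g (m, x, q) = (m, x, q)" for q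
        proof (rule litD(2)[OF g(6) m])
          fix i k assume "(i, k) \<in> \<delta>"
          then show "x \<noteq> site i k m" using False x[of i k] by (cases "(i, k) \<in> \<epsilon>") blast+
        qed
        ultimately show ?thesis by simp
      qed
    qed
  qed
qed

lemma settled_inv:
  assumes "f \<in> settled M" shows "inv_into UNIV f \<in> settled M"
proof -
  obtain \<epsilon> where \<epsilon>: "\<epsilon> \<subseteq> {..3} \<times> {- int M..int M}" "lit \<epsilon> M f"
    using settledD(5)[OF assms] by blast
  note f = settledD(1-4)[OF assms] \<epsilon>
  have inv: "inv_into UNIV f b = a" if "f a = b" for a b
    using f(1) that by (metis bij_inv_eq_iff)
  show ?thesis
  proof (rule settledI)
    show "bij (inv_into UNIV f)" using f(1) by (rule bij_imp_bij_inv)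
    have "base \<circ> f \<circ> inv_into UNIV f = base"
      by (simp only: comp_assoc surj_iff[THEN iffD1, OF bij_is_surj[OF f(1)]] comp_id)
    then show "base \<circ> inv_into UNIV f = base" unfolding f(2) .
    show "inv_into UNIV f (m, x, v, c) = (m, x, v, c)" if "x \<notin> {0..<4 ^ Suc m}" for m x v c
      by (rule inv[OF f(3)[OF that]])
    show "inv_into UNIV f (m, x, v, c) = (m, x, v, c)" if "length (word m) < v" for m x v c
      by (rule inv[OF f(4)[OF that]])
    show "\<epsilon> \<subseteq> {..3} \<times> {- int M..int M}" by (rule f(5))
    show "lit \<epsilon> M (inv_into UNIV f)"
    proof (rule litI)
      fix m x p i k assume m: "M \<le> m" and ik: "(i, k) \<in> \<epsilon>" and x: "x = site i k m"
      have "f (m, x, lamp i m p) = (m, x, p)"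
        unfolding x using litD(1)[OF f(6) m ik, of "lamp i m p"] by (simp add: lamp_lamp del: lamp.simps)
      then show "inv_into UNIV f (m, x, p) = (m, x, lamp i m p)" by (rule inv)
    next
      fix m x p assume m: "M \<le> m" and x: "\<And>i k. (i, k) \<in> \<epsilon> \<Longrightarrow> x \<noteq> site i k m"
      show "inv_into UNIV f (m, x, p) = (m, x, p)"
        by (rule inv[OF litD(2)[OF f(6) m x]])
    qed
  qed
qed

text \<open>Conjugation by \<open>shift l\<close> replaces each \<open>k\<close> by
  \<open>k + l\<close>, which enlarges the bound by \<open>\<bar>l\<bar>\<close>.\<close>

lemma settled_shift:
  assumes "f \<in> settled M" shows "shift l \<circ> f \<circ> shift (- l) \<in> settled (M + nat \<bar>l\<bar>)"
proof -
  obtain \<epsilon> where \<epsilon>: "\<epsilon> \<subseteq> {..3} \<times> {- int M..int M}" "lit \<epsilon> M f"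
    using settledD(5)[OF assms] by blast
  note f = settledD(1-4)[OF assms] \<epsilon>
  have unshift: "shift l (m, y, p) = (m, x, p)"
    if "y = (x + - l) mod 4 ^ Suc m" "x \<in> {0..<4 ^ Suc m}" for m x y p
  proof -
    have "(y + l) mod 4 ^ Suc m = x" using that by (simp add: mod_simps)
    moreover have "y \<in> {0..<4 ^ Suc m}" using that by simp
    ultimately show ?thesis by (simp del: power_Suc)
  qed
  show ?thesis
  proof (rule settledI)
    show "bij (shift l \<circ> f \<circ> shift (- l))" using f(1) by (intro bij_comp bij_shift)
    have "base \<circ> (shift l \<circ> f \<circ> shift (- l)) = rot l \<circ> (base \<circ> f) \<circ> shift (- l)"
      by (simp only: o_assoc base_shift)
    also have "\<dots> = rot l \<circ> rot (- l) \<circ> base" by (simp only: f(2) o_assoc[symmetric] base_shift)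
    also have "\<dots> = base" by (simp add: rot_comp rot_0)
    finally show "base \<circ> (shift l \<circ> f \<circ> shift (- l)) = base" .
    show out: "(shift l \<circ> f \<circ> shift (- l)) (m, x, v, c) = (m, x, v, c)" if "x \<notin> {0..<4 ^ Suc m}" for m x v c
    proof -
      have s: "shift k (m, x, v, c) = (m, x, v, c)" for k using that by (auto simp del: power_Suc)
      show ?thesis by (simp only: o_apply s f(3)[OF that])
    qed
    show "(shift l \<circ> f \<circ> shift (- l)) (m, x, v, c) = (m, x, v, c)" if v: "length (word m) < v" for m x v c
    proof (cases "x \<in> {0..<4 ^ Suc m}")
      case True
      then have s: "shift (- l) (m, x, v, c) = (m, (x + - l) mod 4 ^ Suc m, v, c)" by (simp del: power_Suc)
      show ?thesis by (simp only: o_apply s f(4)[OF v] unshift[OF refl True])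
    qed (rule out)
    let ?\<delta> = "(\<lambda>(i, k). (i, k + l)) ` \<epsilon>"
    show "?\<delta> \<subseteq> {..3} \<times> {- int (M + nat \<bar>l\<bar>)..int (M + nat \<bar>l\<bar>)}"
      using f(5) by (auto simp: subset_iff) force+
    show "lit ?\<delta> (M + nat \<bar>l\<bar>) (shift l \<circ> f \<circ> shift (- l))"
    proof (rule litI)
      fix m x p i k assume "M + nat \<bar>l\<bar> \<le> m" and ik: "(i, k) \<in> ?\<delta>" and x: "x = site i k m"
      then have m: "M \<le> m" by simp
      have ik': "(i, k - l) \<in> \<epsilon>" using ik by auto
      have r: "x \<in> {0..<4 ^ Suc m}" unfolding x by (rule site_range)
      have y: "(x + - l) mod 4 ^ Suc m = site i (k - l) m"
        unfolding x site_shift by simp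
      have s: "shift (- l) (m, x, p) = (m, site i (k - l) m, p)"
        using r y by (simp del: power_Suc)
      show "(shift l \<circ> f \<circ> shift (- l)) (m, x, p) = (m, x, lamp i m p)"
        by (simp only: o_apply s litD(1)[OF f(6) m ik'] unshift[OF y[symmetric] r])
    next
      fix m x p assume "M + nat \<bar>l\<bar> \<le> m" and x: "\<And>i k. (i, k) \<in> ?\<delta> \<Longrightarrow> x \<noteq> site i k m"
      then have m: "M \<le> m" by simp
      show "(shift l \<circ> f \<circ> shift (- l)) (m, x, p) = (m, x, p)"
      proof (cases "x \<in> {0..<4 ^ Suc m}")
        case True
        then have s: "shift (- l) (m, x, p) = (m, (x + - l) mod 4 ^ Suc m, p)" by (simp del: power_Suc)
        have "f (m, (x + - l) mod 4 ^ Suc m, p) = (m, (x + - l) mod 4 ^ Suc m, p)"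
        proof (rule litD(2)[OF f(6) m])
          fix i k assume ik: "(i, k) \<in> \<epsilon>"
          show "(x + - l) mod 4 ^ Suc m \<noteq> site i k m"
          proof
            assume "(x + - l) mod 4 ^ Suc m = site i k m"
            then have "((x + - l) mod 4 ^ Suc m + l) mod 4 ^ Suc m = site i (k + l) m"
              by (simp only: site_shift)
            then have "x = site i (k + l) m" using True by (simp add: mod_simps)
            moreover have "(i, k + l) \<in> ?\<delta>" using ik by force
            ultimately show False using x by blast
          qed
        qed
        then show ?thesis by (simp only: o_apply s unshift[OF refl True])
      next
        case False
        then show ?thesis using out[OF False] by (cases p) simp
      qed
    qed
  qed
qed

text \<open>A member is determined by the set \<open>\<epsilon>\<close>, for which there are
  finitely many choices, and by its restriction to the finite invariant set \<open>\<Phi>\<close> of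
  the points on streets and paths below level \<open>M\<close>.\<close>

lemma finite_settled: "finite (settled M)"
proof -
  let ?box = "{..3} \<times> {- int M..int M} :: (nat \<times> int) set"
  define \<Phi> :: "point set" where
    "\<Phi> = (SIGMA m:{..<M}. {0..<4 ^ Suc m} \<times> {..length (word m)} \<times> UNIV)"
  have fin\<Phi>: "finite \<Phi>"
    unfolding \<Phi>_def by (intro finite_SigmaI finite_cartesian_product) auto
  have "finite {f \<in> settled M. lit \<epsilon> M f}" for \<epsilon>
  proof (rule inj_on_finite[OF _ _ finite_PiE[OF fin\<Phi> fin\<Phi>]])
    show "inj_on (\<lambda>f. restrict f \<Phi>) {f \<in> settled M. lit \<epsilon> M f}"
    proof (rule inj_onI)
      fix f g assume f: "f \<in> {f \<in> settled M. lit \<epsilon> M f}" and g: "g \<in> {f \<in> settled M. lit \<epsilon> M f}"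
        and eq: "restrict f \<Phi> = restrict g \<Phi>"
      have f': "x \<notin> {0..<4 ^ Suc m} \<or> length (word m) < v \<Longrightarrow> f (m, x, v, c) = (m, x, v, c)" for m x v c
        using f unfolding settled_def by blast
      have g': "x \<notin> {0..<4 ^ Suc m} \<or> length (word m) < v \<Longrightarrow> g (m, x, v, c) = (m, x, v, c)" for m x v c
        using g unfolding settled_def by blast
      show "f = g"
      proof
        fix a :: point
        obtain m x v c where a: "a = (m, x, v, c)" by (cases a)
        consider "a \<in> \<Phi>" | "x \<notin> {0..<4 ^ Suc m} \<or> length (word m) < v" | "M \<le> m"
        proof -
          have "a \<in> \<Phi> \<or> (x \<notin> {0..<4 ^ Suc m} \<or> length (word m) < v) \<or> M \<le> m"
            unfolding a \<Phi>_def by (auto simp: not_less simp del: power_Suc)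
          then show ?thesis using that by blast
        qed
        then show "f a = g a"
        proof cases
          case 1
          then show ?thesis using fun_cong[OF eq, of a] by simp
        next
          case 2
          then show ?thesis unfolding a using f' g' by simp
        next
          case 3
          have l: "lit \<epsilon> M f" "lit \<epsilon> M g" using f g by simp_all
          show ?thesis
          proof (cases "\<exists>i k. (i, k) \<in> \<epsilon> \<and> x = site i k m")
            case True
            then obtain i k where ik: "(i, k) \<in> \<epsilon>" "x = site i k m" by blast
            show ?thesis
              unfolding a ik(2) litD(1)[OF l(1) 3 ik(1)] litD(1)[OF l(2) 3 ik(1)] ..
          next
            case False
            have "f (m, x, v, c) = (m, x, v, c)" "g (m, x, v, c) = (m, x, v, c)"
              using False by (intro litD(2)[OF l(1) 3] litD(2)[OF l(2) 3]; blast)+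
            then show ?thesis unfolding a by simp
          qed
        qed
      qed
    qed
    show "(\<lambda>f. restrict f \<Phi>) ` {f \<in> settled M. lit \<epsilon> M f} \<subseteq> \<Phi> \<rightarrow>\<^sub>E \<Phi>"
    proof (rule image_subsetI, rule restrict_PiE_iff[THEN iffD2], rule ballI)
      fix f a assume "f \<in> {f \<in> settled M. lit \<epsilon> M f}" and a: "a \<in> \<Phi>"
      then have f: "bij f" "base \<circ> f = base"
        "\<And>m x v c. length (word m) < v \<Longrightarrow> f (m, x, v, c) = (m, x, v, c)"
        unfolding settled_def by blast+
      obtain m x v c where a': "a = (m, x, v, c)" by (cases a)
      obtain m' x' v' c' where b: "f a = (m', x', v', c')" by (cases "f a")
      have "base (f a) = base a" using fun_cong[OF f(2), of a] by simp
      then have mx: "m' = m" "x' = x" unfolding b unfolding a' by simp_all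
      have "v' \<le> length (word m)"
      proof (rule ccontr)
        assume v': "\<not> v' \<le> length (word m)"
        \<comment> \<open>An image beyond the path would be a fixed point of \<open>f\<close>, hence
          by injectivity equal to \<open>a\<close>, which lies on the path.\<close>
        then have "f (f a) = f a" unfolding b mx by (intro f(3)) simp
        then have "f a = a" using f(1) by (simp add: bij_is_inj inj_eq)
        then have "v' = v" using b a' by simp
        then show False using v' a unfolding a' \<Phi>_def by simp
      qed
      then show "f a \<in> \<Phi>" using a unfolding b mx unfolding a' \<Phi>_def by simp
    qed
  qed
  moreover have "settled M \<subseteq> (\<Union>\<epsilon>\<in>Pow ?box. {f \<in> settled M. lit \<epsilon> M f})"
    unfolding settled_def by blast
  moreover have "finite (Pow ?box)" by simp
  ultimately show ?thesis by (meson finite_UN_I finite_subset)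
qed

text \<open>Conjugation by rotations preserves the union of the sets \<open>settled M\<close>, so
  the elements of this form are a subgroup, and it contains the generators.\<close>

lemma lamp_group_decomp:
  assumes "g \<in> lamp_group" shows "\<exists>k M. \<exists>f\<in>settled M. g = shift k \<circ> f"
proof -
  let ?D = "{g. \<exists>k M. \<exists>f\<in>settled M. g = shift k \<circ> f}"
  have "subgroup ?D perm_group"
  proof (rule perm_subgroupI)
    fix g assume "g \<in> ?D"
    then obtain k M f where f: "f \<in> settled M" "g = shift k \<circ> f" by blast
    show "bij g" unfolding f(2) using settledD(1)[OF f(1)] by (intro bij_comp bij_shift)
    have "inv_into UNIV g = inv_into UNIV f \<circ> shift (- k)"
      unfolding f(2) using settledD(1)[OF f(1)] by (simp add: o_inv_distrib bij_shift inv_shift)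
    also have "\<dots> = shift (- k) \<circ> (shift k \<circ> inv_into UNIV f \<circ> shift (- k))"
      by (simp add: o_assoc shift_comp shift_0)
    finally show "inv_into UNIV g \<in> ?D"
      using settled_shift[OF settled_inv[OF f(1)], of k] by blast
  next
    have "shift 0 \<circ> id \<in> ?D" using id_settled[of 0] by blast
    then show "id \<in> ?D" by (simp only: shift_0 id_comp)
    fix g h assume "g \<in> ?D" "h \<in> ?D"
    then obtain k M f l L e where f: "f \<in> settled M" "g = shift k \<circ> f"
      and e: "e \<in> settled L" "h = shift l \<circ> e" by blast
    \<comment> \<open>Moving \<open>shift l\<close> to the left past \<open>f\<close> conjugates
      \<open>f\<close> by \<open>shift (- l)\<close>; the double negation has the shape of
      \<open>settled_shift\<close>.\<close>
    let ?f = "shift (- l) \<circ> f \<circ> shift (- (- l))"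
    let ?K = "max (M + nat \<bar>- l\<bar>) L"
    have "?f \<in> settled ?K" "e \<in> settled ?K"
      using settled_shift[OF f(1), of "- l"] e(1) settled_mono[of _ ?K] by (meson max.cobounded1 max.cobounded2 subsetD)+
    then have "?f \<circ> e \<in> settled ?K" by (rule settled_comp)
    moreover have "g \<circ> h = shift (k + l) \<circ> (?f \<circ> e)"
    proof -
      have "shift (k + l) \<circ> (?f \<circ> e) = (shift (k + l) \<circ> shift (- l)) \<circ> f \<circ> shift l \<circ> e"
        by (simp add: o_assoc)
      then show ?thesis unfolding shift_comp f(2) e(2) by (simp add: o_assoc)
    qed
    ultimately show "g \<circ> h \<in> ?D" by blast
  qed
  moreover have "gens \<subseteq> ?D"
  proof
    fix g assume "g \<in> gens"
    then consider "g = shift 1" | i where "i \<le> 3" "g = light i 0" by (auto simp: gens_def)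
    then show "g \<in> ?D"
    proof cases
      case 1
      then have "g = shift 1 \<circ> id" by simp
      then show ?thesis using id_settled[of 0] by blast
    next
      case (2 i)
      then have "g = shift 0 \<circ> light i 0" by (simp add: shift_0)
      then show ?thesis using light_settled[OF 2(1), of 0] by blast
    qed
  qed
  ultimately have "lamp_group \<subseteq> ?D"
    unfolding lamp_group_def by (intro group.generate_subgroup_incl[OF group_perm_group])
  then show ?thesis using assms by blast
qed

section \<open>Amenability of the lamp group\<close>

text \<open>On a level whose street is longer than \<open>\<bar>k\<bar>\<close>, rotation by
  \<open>k\<close> fixes house \<open>0\<close> only for \<open>k = 0\<close>.\<close>

lemma rot_eq_id: "rot k \<circ> base = base \<Longrightarrow> k = 0"
proof -
  assume r: "rot k \<circ> base = base"
  define m where "m = nat \<bar>k\<bar>"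
  have "(0 + k) mod 4 ^ Suc m = 0"
    using fun_cong[OF r, of "(m, 0, 0, False)"] by (simp del: power_Suc)
  then have "(4 ^ Suc m :: int) dvd k" by (simp add: dvd_eq_mod_eq_0)
  moreover have "\<bar>k\<bar> < 4 ^ Suc m" using lt_pow4_Suc[of m] by (simp add: m_def)
  ultimately show "k = 0" using zdvd_imp_le[of "4 ^ Suc m" "\<bar>k\<bar>"] by (cases "k = 0") auto
qed

abbreviation "lamp_grp \<equiv> perm_group\<lparr>carrier := lamp_group\<rparr>"
abbreviation "big_grp \<equiv> perm_group\<lparr>carrier := big_group\<rparr>"

lemma group_lamp_grp: "group lamp_grp"
  by (rule subgroup.subgroup_is_group[OF subgroup_lamp_group group_perm_group])

lemma group_big_grp: "group big_grp"
  by (rule subgroup.subgroup_is_group[OF subgroup_big_group group_perm_group])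

lemma inv_lamp_grp: "g \<in> lamp_group \<Longrightarrow> m_inv lamp_grp g = inv_into UNIV g"
  using group.m_inv_consistent[OF group_perm_group subgroup_lamp_group, of g]
    inv_perm_group[OF lamp_groupD(1), of g] by simp

lemma shift_int_pow: "shift 1 [^]\<^bsub>lamp_grp\<^esub> (k::int) = shift k"
proof -
  interpret group lamp_grp by (rule group_lamp_grp)
  have nat: "shift 1 [^]\<^bsub>lamp_grp\<^esub> n = shift (int n)" for n :: nat
    by (induction n) (simp_all add: shift_0 shift_comp add.commute)
  show ?thesis
  proof (cases k rule: int_cases2)
    case (nonneg n)
    then show ?thesis by (simp only: int_pow_int nat)
  next
    case (nonpos n)
    have "shift 1 \<in> carrier lamp_grp" by (simp add: shift_lamp_group)
    then show ?thesis
      by (simp only: nonpos int_pow_neg_int nat inv_lamp_grp[OF shift_lamp_group] inv_shift)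
  qed
qed

text \<open>Every element acts on levels and houses as some \<open>rot k\<close>, so the quotient by
  the kernel \<open>?N\<close> of this action is infinite cyclic, generated by the image of
  \<open>shift 1\<close>. The kernel is the increasing union of the finite groups
  \<open>settled M \<inter> lamp_group\<close>, hence locally finite.\<close>

lemma amenable_lamp_grp: "amenable lamp_grp"
proof (rule amenable_locally_finite_by_int[where t = "shift 1"])
  let ?N = "{g \<in> lamp_group. base \<circ> g = base}"
  interpret group lamp_grp by (rule group_lamp_grp)
  have base: "\<exists>k. base \<circ> g = rot k \<circ> base" if g: "g \<in> lamp_group" for g
  proof -
    obtain k M f where f: "f \<in> settled M" "g = shift k \<circ> f" using lamp_group_decomp[OF g] by blast
    have "base \<circ> g = rot k \<circ> (base \<circ> f)" by (simp only: f(2) o_assoc base_shift)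
    then show ?thesis unfolding settledD(2)[OF f(1)] by blast
  qed
  have inv: "g \<circ> inv_into UNIV g = id" if "g \<in> lamp_group" for g
    using lamp_groupD(1)[OF that] by (simp add: bij_is_surj flip: surj_iff)
  have base_inv: "base \<circ> inv_into UNIV g = rot (- k) \<circ> base"
    if g: "g \<in> lamp_group" "base \<circ> g = rot k \<circ> base" for g k
  proof -
    have "rot (- k) \<circ> base = rot (- k) \<circ> base \<circ> (g \<circ> inv_into UNIV g)" by (simp add: inv[OF g(1)])
    also have "\<dots> = rot (- k) \<circ> (base \<circ> g) \<circ> inv_into UNIV g" by (simp only: o_assoc)
    also have "\<dots> = rot (- k) \<circ> rot k \<circ> base \<circ> inv_into UNIV g" by (simp only: g(2) o_assoc)
    finally show ?thesis by (simp add: rot_comp rot_0)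
  qed
  show "?N \<lhd> lamp_grp"
  proof (rule normal_invI)
    show "subgroup ?N lamp_grp"
    proof (rule subgroupI)
      fix g assume g: "g \<in> ?N"
      then have "base \<circ> g = rot 0 \<circ> base" by (simp add: rot_0)
      then have "base \<circ> inv_into UNIV g = base" using base_inv[of g 0] g by (simp add: rot_0)
      then show "m_inv lamp_grp g \<in> ?N" using g by (simp add: inv_lamp_grp lamp_groupD(4))
    next
      fix g h assume "g \<in> ?N" "h \<in> ?N"
      then show "g \<otimes>\<^bsub>lamp_grp\<^esub> h \<in> ?N" by (simp add: lamp_groupD(3) o_assoc)
    qed (use lamp_groupD(2) in auto)
    fix g n assume "g \<in> carrier lamp_grp" and n: "n \<in> ?N"
    then have g: "g \<in> lamp_group" by simp
    obtain k where k: "base \<circ> g = rot k \<circ> base" using base[OF g] by blast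
    have "base \<circ> (g \<circ> n \<circ> inv_into UNIV g) = rot k \<circ> (base \<circ> n) \<circ> inv_into UNIV g"
      by (simp only: o_assoc k)
    also have "\<dots> = rot k \<circ> (base \<circ> inv_into UNIV g)" using n by (simp add: o_assoc)
    also have "\<dots> = base" by (simp only: base_inv[OF g k] o_assoc rot_comp) (simp add: rot_0)
    finally show "g \<otimes>\<^bsub>lamp_grp\<^esub> n \<otimes>\<^bsub>lamp_grp\<^esub> m_inv lamp_grp g \<in> ?N"
      using g n by (simp add: inv_lamp_grp lamp_groupD(3,4))
  qed
  show "shift 1 \<in> carrier lamp_grp" by (simp add: shift_lamp_group)
  show "\<exists>k::int. shift 1 [^]\<^bsub>lamp_grp\<^esub> k \<otimes>\<^bsub>lamp_grp\<^esub> g \<in> ?N" if "g \<in> carrier lamp_grp" for g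
  proof -
    have g: "g \<in> lamp_group" using that by simp
    obtain k M f where f: "f \<in> settled M" "g = shift k \<circ> f" using lamp_group_decomp[OF g] by blast
    have "shift (- k) \<circ> g = f" by (simp add: f(2) o_assoc shift_comp shift_0)
    moreover have "shift (- k) \<circ> g \<in> lamp_group" by (rule lamp_groupD(3)[OF shift_lamp_group g])
    ultimately have "shift (- k) \<circ> g \<in> ?N" using settledD(2)[OF f(1)] by simp
    then show ?thesis by (intro exI[of _ "- k"]) (simp add: shift_int_pow)
  qed
  show "k = 0" if "shift 1 [^]\<^bsub>lamp_grp\<^esub> (k::int) \<in> ?N" for k
    using that by (intro rot_eq_id) (simp add: shift_int_pow base_shift)
  fix S assume S: "finite S" "S \<subseteq> ?N"
  have "\<exists>M. g \<in> settled M" if g: "g \<in> ?N" for g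
  proof -
    have g': "g \<in> lamp_group" "base \<circ> g = base" using g by simp_all
    obtain k M f where f: "f \<in> settled M" "g = shift k \<circ> f" using lamp_group_decomp[OF g'(1)] by blast
    have "base \<circ> g = rot k \<circ> (base \<circ> f)" by (simp only: f(2) o_assoc base_shift)
    then have "rot k \<circ> base = base" unfolding g'(2) settledD(2)[OF f(1)] by (rule sym)
    then have "g = f" using rot_eq_id[of k] f(2) by (simp add: shift_0)
    then show ?thesis using f(1) by blast
  qed
  then have "\<exists>L. \<forall>g\<in>?N. g \<in> settled (L g)" by (intro bchoice ballI)
  then obtain L where L: "\<forall>g\<in>?N. g \<in> settled (L g)" by (rule exE)
  \<comment> \<open>As the sets \<open>settled M\<close> increase, one index serves all of the
    finite set \<open>S\<close>; the inserted \<open>0\<close> covers the empty set.\<close>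
  define M where "M = Max (insert 0 (L ` S))"
  have "S \<subseteq> settled M"
  proof
    fix g assume g: "g \<in> S"
    then have "L g \<le> M" unfolding M_def using S(1) by (intro Max_ge) auto
    moreover have "g \<in> settled (L g)" using subsetD[OF S(2) g] by (rule bspec[OF L])
    ultimately show "g \<in> settled M" using settled_mono[of "L g" M] by blast
  qed
  moreover have "settled M \<inter> lamp_group \<subseteq> ?N" using settledD(2) by blast
  moreover have "finite (settled M \<inter> lamp_group)" using finite_settled by blast
  moreover have "subgroup (settled M \<inter> lamp_group) lamp_grp"
  proof (rule subgroupI)
    fix g assume "g \<in> settled M \<inter> lamp_group"
    then show "m_inv lamp_grp g \<in> settled M \<inter> lamp_group"
      by (simp add: inv_lamp_grp settled_inv lamp_groupD(4))
  next
    show "settled M \<inter> lamp_group \<noteq> {}" using id_settled lamp_groupD(2) by blast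
  qed (auto simp: settled_comp lamp_groupD(3))
  ultimately show "\<exists>K. finite K \<and> subgroup K lamp_grp \<and> S \<subseteq> K \<and> K \<subseteq> ?N"
    using S(2) by (intro exI[of _ "settled M \<inter> lamp_group"]) auto
qed

section \<open>Non-amenability of the big group\<close>

text \<open>The criterion for free involutions takes its letters from a whole type;
  \<open>bool option\<close> has three elements, matching the three twists.\<close>

definition place :: "bool option \<Rightarrow> nat" where
  "place l = (case l of None \<Rightarrow> 1 | Some b \<Rightarrow> if b then 2 else 3)"

text \<open>A nonempty reduced word is, up to \<open>place\<close>, the word of some level, and
  there its product moves one end of the path at house \<open>0\<close> to the other.\<close>

lemma not_amenable_big_grp: "\<not> amenable big_grp"
proof -
  interpret group big_grp by (rule group_big_grp)
  let ?s = "\<lambda>l. twist (place l)"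
  have place: "place l \<in> {1..3}" for l by (auto simp: place_def split: option.split)
  have inj: "inj place"
    by (auto simp: inj_def place_def split: option.splits if_splits)
  show ?thesis
  proof (rule not_amenable_if_free_involutions[where s = ?s])
    show "range ?s \<subseteq> carrier big_grp"
      using place by (auto simp: big_group_def twists_def intro!: generate.incl)
    show "?s l \<otimes>\<^bsub>big_grp\<^esub> ?s l = \<one>\<^bsub>big_grp\<^esub>" for l by (simp add: twist_twist)
    show "distinct [None, Some True, Some False]" by simp
    fix w :: "bool option list" assume w: "distinct_adj w" "w \<noteq> []"
    have "distinct_adj (map place w)" using w(1) inj by (simp add: distinct_adj_map_iff inj_on_subset)
    then obtain m where m: "word m = map place w" using word_surj by blast
    \<comment> \<open>The letters act from the last to the first, so the suffix from
      \<open>j\<close> on has moved the far end down to \<open>j\<close>.\<close>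
    have "word_prod ?s (drop j w) (m, 0, length w, False) = (m, 0, j, False)" if "j \<le> length w" for j
      using that
    proof (induction rule: inc_induct)
      case (step j)
      have d: "drop j w = w ! j # drop (Suc j) w" using step.hyps(2) by (rule Cons_nth_drop_Suc[symmetric])
      have "word_prod ?s (drop j w) (m, 0, length w, False) = ?s (w ! j) (m, 0, Suc j, False)"
        unfolding d using step.IH by simp
      also have "\<dots> = (m, 0, j, False)"
      proof -
        \<comment> \<open>\<open>step\<close> tests the edge above \<open>Suc j\<close> first; as
          \<open>w\<close> is reduced, that edge carries another letter, and so \<open>w ! j\<close>
          leads down to \<open>j\<close>.\<close>
        have "Suc j < length w \<Longrightarrow> w ! Suc j \<noteq> w ! j" using distinct_adj_nth[OF w(1), of j] by auto
        then show ?thesis using step.hyps(2) inj by (auto simp: m step_def inj_eq)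
      qed
      finally show ?case .
    qed simp
    from this[of 0] have "word_prod ?s w (m, 0, length w, False) = (m, 0, 0, False)" by simp
    then show "word_prod ?s w \<noteq> \<one>\<^bsub>big_grp\<^esub>" using w(2) by auto
  qed
qed

section \<open>Finite generation and conclusion\<close>

lemma finitely_generated_subgroup_generate:
  assumes "group G" "finite S" "S \<subseteq> carrier G"
  shows "finitely_generated (G\<lparr>carrier := generate G S\<rparr>)"
proof -
  have sub: "subgroup (generate G S) G" by (rule group.generate_is_subgroup[OF assms(1,3)])
  have inc: "S \<subseteq> generate G S" using generate.incl by fast
  have "generate (G\<lparr>carrier := generate G S\<rparr>) S = generate G S"
    by (rule group.generate_consistent[OF assms(1) inc sub])
  then show ?thesis unfolding finitely_generated_def using assms(2) inc by auto
qed

theorem corollary3p10: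
  shows "\<exists>(G :: nat monoid) (H :: nat monoid) (\<Gamma> :: nat \<Rightarrow> nat set) (\<Delta> :: nat \<Rightarrow> nat set).
    Group.group G \<and> finitely_generated G \<and> residually_finite G \<and> amenable G \<and>
    Group.group H \<and> finitely_generated H \<and> residually_finite H \<and> \<not> amenable H \<and>
    subgroup_scale G \<Gamma> \<and> subgroup_scale H \<Delta> \<and>
    odometer_full_group G \<Gamma> \<cong> odometer_full_group H \<Delta>"
proof (rule odometer_full_groups_on_nat)
  have fin: "finite (gens \<union> twists)" by (simp add: gens_def twists_def)
  show "group big_grp" by (rule group_big_grp)
  show "countable (carrier big_grp)"
    using countable_generate[OF countable_finite[OF fin]] by (simp add: big_group_def)
  show "subgroup lamp_group big_grp"
    by (rule group.subgroup_incl[OF group_perm_group subgroup_lamp_group subgroup_big_group lamp_group_subset])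
  show "subgroup_scale big_grp (\<lambda>n. {h \<in> big_group. \<forall>a\<in>window n. h a = a})"
    by (rule permutation_subgroup_scale[OF subgroup_big_group finite_window window_mono window_cover big_group_window])
  show "\<exists>g\<in>lamp_group. h \<in> {h \<in> big_group. \<forall>a\<in>window n. h a = a} #>\<^bsub>big_grp\<^esub> g"
    if "h \<in> carrier big_grp" for n h
  proof -
    have h: "h \<in> big_group" using that by simp
    obtain g where g: "g \<in> lamp_group" "\<And>a. a \<in> window n \<Longrightarrow> h a = g a"
      using lamp_group_dense[OF h, of n] by blast
    have g': "g \<in> big_group" using g(1) lamp_group_subset by blast
    have inv: "g \<circ> inv_into UNIV g = id" "inv_into UNIV g \<circ> g = id"
      using big_groupD(1)[OF g'] by (simp_all add: bij_is_inj bij_is_surj flip: surj_iff)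
    \<comment> \<open>\<open>g\<close> approximates \<open>h\<close> on the window, and the inverse
      of \<open>g\<close> preserves the window, so the quotient \<open>?d\<close> lies in the
      stabiliser.\<close>
    let ?d = "h \<circ> inv_into UNIV g"
    have "?d a = a" if a: "a \<in> window n" for a
    proof -
      have "inv_into UNIV g a \<in> window n"
        using big_group_window[OF big_groupD(4)[OF g'], of n] a by blast
      from g(2)[OF this] show ?thesis using fun_cong[OF inv(1), of a] by simp
    qed
    then have "?d \<in> {h \<in> big_group. \<forall>a\<in>window n. h a = a}"
      using big_groupD(3)[OF h big_groupD(4)[OF g']] by simp
    moreover have "h = ?d \<otimes>\<^bsub>big_grp\<^esub> g" by (simp add: o_assoc[symmetric] inv(2))
    ultimately show ?thesis using g(1) unfolding r_coset_def by blast
  qed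
  show "finitely_generated (big_grp\<lparr>carrier := lamp_group\<rparr>)"
    using finitely_generated_subgroup_generate[OF group_perm_group, of gens] fin bij_gens
    by (simp add: lamp_group_def)
  show "finitely_generated big_grp"
    using finitely_generated_subgroup_generate[OF group_perm_group fin bij_gens]
    by (simp add: big_group_def)
  show "amenable (big_grp\<lparr>carrier := lamp_group\<rparr>)" using amenable_lamp_grp by simp
  show "\<not> amenable big_grp" by (rule not_amenable_big_grp)
qed

end
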